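(* Let $k\ge 0$ and $\varepsilon\in\{0,1,2\}$ be integers with $d=3k+\varepsilon\ge 1$. Put $$\ell=\tfrac{1}{2}(3k+5+2\varepsilon)k+1+\varepsilon,\qquad p=(k+1)\,\delta_{2,\varepsilon},$$ where $\delta_{2,\varepsilon}$ is the Kronecker symbol ($1$ if $\varepsilon=2$, $0$ otherwise). Let $Y=Y(\ell,p)\subset\mathbb{P}^3$ be the reduced subscheme consisting of $\ell$ general lines together with $p$ general points lying on one further line $L_0$, where $L_0$ is general with respect to the $\ell$ lines (the line $L_0$ itself is not part of $Y$). Then the restriction map $$H^0(\mathbb{P}^3,\mathcal{O}_{\mathbb{P}^3}(d))\longrightarrow H^0(Y,\mathcal{O}_{Y}(d))$$ is an isomorphism.
   Context: We work over an algebraically closed field (of characteristic zero). "General" means that the configuration lies in a suitable dense Zariski-open subset of the relevant parameter space (products of Grassmannians of lines, of points on a line, etc.). The numbers $\ell,p$ are chosen so that both sides of the restriction map have the same dimension $\binom{d+3}{3}$. *)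

theory Defs
  imports Main
begin

class alg_closed_char0 = field_char_0 +
  assumes alg_closed: "0 < n \<Longrightarrow> c n \<noteq> 0 \<Longrightarrow> \<exists>x. (\<Sum>i\<le>n. c i * x ^ i) = 0"

text \<open>Homogeneous forms of degree d in 4 variables x_0..x_3, given by coefficient
  functions on exponent vectors (exponent vectors are nat => nat supported in {0..3}).\<close>
definition mons :: "nat \<Rightarrow> (nat \<Rightarrow> nat) set" where
  "mons d = {\<alpha>. (\<forall>i\<ge>4. \<alpha> i = 0) \<and> sum \<alpha> {0..<4} = d}"

definition forms :: "nat \<Rightarrow> ((nat \<Rightarrow> nat) \<Rightarrow> 'a::field) set" where
  "forms d = {c. \<forall>\<alpha>. \<alpha> \<notin> mons d \<longrightarrow> c \<alpha> = 0}"

definition evalF :: "nat \<Rightarrow> ((nat \<Rightarrow> nat) \<Rightarrow> 'a::field) \<Rightarrow> (nat \<Rightarrow> 'a) \<Rightarrow> 'a" where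
  "evalF d c x = (\<Sum>\<alpha>\<in>mons d. c \<alpha> * (\<Prod>i<4. x i ^ \<alpha> i))"

text \<open>Binary forms of degree d (= H^0(P^1, O(d))), as functions of (s,t).\<close>
definition binforms :: "nat \<Rightarrow> ('a::field \<times> 'a \<Rightarrow> 'a) set" where
  "binforms d = {g. \<exists>\<beta>. g = (\<lambda>(s,t). \<Sum>j\<le>d. \<beta> j * s ^ j * t ^ (d - j))}"

text \<open>Parameters of a configuration: line i (i < l) spanned by vectors VA i _ and VB i _;
  the line L_0 spanned by VC _ and VE _; the j-th point on L_0 is VU j * C + VV j * E.\<close>
datatype pvar = VA nat nat | VB nat nat | VC nat | VE nat | VU nat | VV nat

inductive poly_fun :: "(('v \<Rightarrow> 'a::comm_ring_1) \<Rightarrow> 'a) \<Rightarrow> bool" where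
  pf_const: "poly_fun (\<lambda>z. c)"
| pf_var: "poly_fun (\<lambda>z. z v)"
| pf_add: "poly_fun f \<Longrightarrow> poly_fun g \<Longrightarrow> poly_fun (\<lambda>z. f z + g z)"
| pf_mult: "poly_fun f \<Longrightarrow> poly_fun g \<Longrightarrow> poly_fun (\<lambda>z. f z * g z)"

text \<open>A property holds for a general configuration: it holds on a nonempty
  Zariski-open subset D(G) of parameter space.\<close>
definition general :: "((pvar \<Rightarrow> 'a::comm_ring_1) \<Rightarrow> bool) \<Rightarrow> bool" where
  "general P \<longleftrightarrow> (\<exists>G. poly_fun G \<and> (\<exists>z. G z \<noteq> 0) \<and> (\<forall>z. G z \<noteq> 0 \<longrightarrow> P z))"

definition line_vec :: "(pvar \<Rightarrow> 'a::field) \<Rightarrow> nat \<Rightarrow> 'a \<Rightarrow> 'a \<Rightarrow> nat \<Rightarrow> 'a" where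
  "line_vec z i s t = (\<lambda>m. s * z (VA i m) + t * z (VB i m))"

definition point_vec :: "(pvar \<Rightarrow> 'a::field) \<Rightarrow> nat \<Rightarrow> nat \<Rightarrow> 'a" where
  "point_vec z j = (\<lambda>m. z (VU j) * z (VC m) + z (VV j) * z (VE m))"

text \<open>Restriction map H^0(P^3,O(d)) -> H^0(Y,O_Y(d)) = (+)_{i<l} H^0(L_i,O(d)) (+) k^p.\<close>
definition restr_map :: "nat \<Rightarrow> nat \<Rightarrow> nat \<Rightarrow> (pvar \<Rightarrow> 'a::field) \<Rightarrow> ((nat \<Rightarrow> nat) \<Rightarrow> 'a)
     \<Rightarrow> (nat \<Rightarrow> 'a \<times> 'a \<Rightarrow> 'a) \<times> (nat \<Rightarrow> 'a)" where
  "restr_map d l p z c =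
     ((\<lambda>i. if i < l then (\<lambda>(s,t). evalF d c (line_vec z i s t)) else (\<lambda>_. 0)),
      (\<lambda>j. if j < p then evalF d c (point_vec z j) else 0))"

definition restr_target :: "nat \<Rightarrow> nat \<Rightarrow> nat \<Rightarrow> ((nat \<Rightarrow> 'a::field \<times> 'a \<Rightarrow> 'a) \<times> (nat \<Rightarrow> 'a)) set" where
  "restr_target d l p = {(g, v). (\<forall>i<l. g i \<in> binforms d) \<and> (\<forall>i\<ge>l. g i = (\<lambda>_. 0)) \<and> (\<forall>j\<ge>p. v j = 0)}"

end

theory Submission
  imports Defs "HOL-Computational_Algebra.Polynomial"
begin

text \<open>
  It suffices to find one configuration on which no nonzero form of degree \<open>d\<close> vanishes:
  triviality of the kernel is an open condition, and both sides have the same dimension. All lines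
  are chords of the quadric \<open>x\<^sub>0 x\<^sub>3 = x\<^sub>1 x\<^sub>2\<close>. If some of them are specialised to members of
  one ruling, then a form vanishing on the configuration restricts to a form of bidegree \<open>(d, d)\<close>
  which vanishes on these rulings and in the points where the other lines meet the quadric. When this
  forces the restriction to be zero, the form is a multiple of the quadric, and the cofactor of
  degree \<open>d - 2\<close> vanishes on the remaining lines.

  This leads from degree \<open>3 k - 2\<close> to \<open>3 k\<close> and from \<open>3 k\<close> to \<open>3 k + 2\<close>. To reach degree
  \<open>3 k + 1\<close>, let \<open>3 k\<close> of the lines degenerate to \<open>k\<close> chains of three lines whose nodes lie on
  the quadric. In the limit each node becomes a double point of the trace and an ordinary node of
  the residual configuration in degree \<open>3 k - 1\<close>. There the outer lines of the chains are
  specialised to rulings, which leaves general lines in degree \<open>3 k - 3\<close>.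
\<close>

section \<open>Generic properties\<close>

definition generic :: "(('v \<Rightarrow> 'a::comm_ring_1) \<Rightarrow> bool) \<Rightarrow> bool" where
  "generic P \<longleftrightarrow> (\<exists>G. poly_fun G \<and> (\<exists>z. G z \<noteq> 0) \<and> (\<forall>z. G z \<noteq> 0 \<longrightarrow> P z))"

lemma genericI: "poly_fun G \<Longrightarrow> G z \<noteq> 0 \<Longrightarrow> (\<And>z. G z \<noteq> 0 \<Longrightarrow> P z) \<Longrightarrow> generic P"
  unfolding generic_def by blast

lemma generic_witness: "generic P \<Longrightarrow> \<exists>z. P z"
  unfolding generic_def by blast

lemma generic_mono: "generic P \<Longrightarrow> (\<And>z. P z \<Longrightarrow> Q z) \<Longrightarrow> generic Q"
  unfolding generic_def by blast

lemma poly_fun_diff: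
  assumes "poly_fun f" "poly_fun g"
  shows "poly_fun (\<lambda>z. f z - g z)"
proof -
  have "poly_fun (\<lambda>z. f z + (-1) * g z)"
    by (intro poly_fun.intros assms)
  then show ?thesis by simp
qed

lemma poly_fun_power: "poly_fun f \<Longrightarrow> poly_fun (\<lambda>z. f z ^ n)"
  by (induction n) (auto intro: poly_fun.intros)

lemma poly_fun_sum: "(\<And>i. i \<in> A \<Longrightarrow> poly_fun (f i)) \<Longrightarrow> poly_fun (\<lambda>z. \<Sum>i\<in>A. f i z)"
  by (induction A rule: infinite_finite_induct) (auto intro: poly_fun.intros)

lemma poly_fun_prod: "(\<And>i. i \<in> A \<Longrightarrow> poly_fun (f i)) \<Longrightarrow> poly_fun (\<lambda>z. \<Prod>i\<in>A. f i z)"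
  by (induction A rule: infinite_finite_induct) (auto intro: poly_fun.intros)

lemmas poly_fun_intros =
  poly_fun.intros poly_fun_diff poly_fun_power poly_fun_sum poly_fun_prod

lemma poly_fun_on_line:
  fixes G :: "('v \<Rightarrow> 'a::comm_ring_1) \<Rightarrow> 'a"
  assumes "poly_fun G"
  shows "\<exists>p. \<forall>t. poly p t = G (\<lambda>v. z v + t * y v)"
  using assms
proof induction
  case (pf_const c)
  show ?case by (rule exI[of _ "[:c:]"]) simp
next
  case (pf_var v)
  show ?case by (rule exI[of _ "[:z v, y v:]"]) simp
next
  case (pf_add f g)
  then obtain p q where "\<forall>t. poly p t = f (\<lambda>v. z v + t * y v)"
    and "\<forall>t. poly q t = g (\<lambda>v. z v + t * y v)" by blast
  then show ?case by (intro exI[of _ "p + q"]) simp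
next
  case (pf_mult f g)
  then obtain p q where "\<forall>t. poly p t = f (\<lambda>v. z v + t * y v)"
    and "\<forall>t. poly q t = g (\<lambda>v. z v + t * y v)" by blast
  then show ?case by (intro exI[of _ "p * q"]) simp
qed

lemma poly_fun_common_nonzero:
  fixes G H :: "('v \<Rightarrow> 'a::field_char_0) \<Rightarrow> 'a"
  assumes "poly_fun G" "G z \<noteq> 0" "poly_fun H" "H y \<noteq> 0"
  shows "\<exists>w. G w \<noteq> 0 \<and> H w \<noteq> 0"
proof -
  obtain p where poly_p: "\<And>t. poly p t = G (\<lambda>v. z v + t * (y v - z v))"
    using poly_fun_on_line[OF assms(1), of z "\<lambda>v. y v - z v"] by blast
  obtain q where poly_q: "\<And>t. poly q t = H (\<lambda>v. z v + t * (y v - z v))"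
    using poly_fun_on_line[OF assms(3), of z "\<lambda>v. y v - z v"] by blast
  have "poly p 0 \<noteq> 0" "poly q 1 \<noteq> 0" using assms(2,4) by (simp_all add: poly_p poly_q)
  then have "p * q \<noteq> 0" by auto
  then obtain t where "poly (p * q) t \<noteq> 0" using poly_all_0_iff_0 by blast
  then show ?thesis by (auto simp: poly_p poly_q)
qed

lemma poly_fun_eq_0_if_eq_0_off_zeros:
  fixes G H :: "('v \<Rightarrow> 'a::field_char_0) \<Rightarrow> 'a"
  assumes "poly_fun G" "poly_fun H" "H y \<noteq> 0" "\<And>z. H z \<noteq> 0 \<Longrightarrow> G z = 0"
  shows "G z = 0"
  using poly_fun_common_nonzero[of G z H y] assms by blast

lemma generic_conj:
  fixes P Q :: "('v \<Rightarrow> 'a::field_char_0) \<Rightarrow> bool"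
  assumes "generic P" "generic Q"
  shows "generic (\<lambda>z. P z \<and> Q z)"
proof -
  obtain G z H y where poly: "poly_fun G" "poly_fun H" and nonzero: "G z \<noteq> 0" "H y \<noteq> 0"
    and "\<And>z. G z \<noteq> 0 \<Longrightarrow> P z" "\<And>z. H z \<noteq> 0 \<Longrightarrow> Q z"
    using assms unfolding generic_def by blast
  moreover obtain w where "G w \<noteq> 0" "H w \<noteq> 0"
    using poly_fun_common_nonzero[OF poly(1) nonzero(1) poly(2) nonzero(2)] by blast
  ultimately show ?thesis
    by (intro genericI[of "\<lambda>z. G z * H z" w]) (auto intro: poly_fun.intros)
qed

lemma generic_ball:
  fixes P :: "'i \<Rightarrow> ('v \<Rightarrow> 'a::field_char_0) \<Rightarrow> bool"
  assumes "finite A" "\<And>i. i \<in> A \<Longrightarrow> generic (P i)"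
  shows "generic (\<lambda>z. \<forall>i\<in>A. P i z)"
  using assms
proof (induction A rule: finite_induct)
  case empty
  show ?case by (rule genericI[of "\<lambda>_. 1"]) (auto intro: poly_fun.intros)
next
  case (insert x F)
  have "generic (\<lambda>z. P x z \<and> (\<forall>i\<in>F. P i z))"
    using insert by (intro generic_conj) auto
  then show ?case by simp
qed

lemma generic_neq:
  assumes "v \<noteq> v'"
  shows "generic (\<lambda>w :: 'v \<Rightarrow> 'a::comm_ring_1. w v \<noteq> w v')"
  by (rule genericI[of "\<lambda>w. w v - w v'" "\<lambda>u. if u = v then 1 else 0"])
    (use assms in \<open>auto intro: poly_fun_intros\<close>)

section \<open>Linear systems with trivial kernel\<close>

definition kernel :: "'j set \<Rightarrow> ('j \<Rightarrow> 'a::field) set \<Rightarrow> ('j \<Rightarrow> 'a) set" where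
  "kernel J R = {c. \<forall>r\<in>R. (\<Sum>j\<in>J. c j * r j) = 0}"

definition trivial_kernel :: "'j set \<Rightarrow> ('j \<Rightarrow> 'a::field) set \<Rightarrow> bool" where
  "trivial_kernel J R \<longleftrightarrow> (\<forall>c\<in>kernel J R. \<forall>j\<in>J. c j = 0)"

lemma kernel_Un: "kernel J (R \<union> S) = kernel J R \<inter> kernel J S"
  by (auto simp: kernel_def)

lemma trivial_kernel_if_kernel_subset:
  "trivial_kernel J R \<Longrightarrow> kernel J S \<subseteq> kernel J R \<Longrightarrow> trivial_kernel J S"
  unfolding trivial_kernel_def by blast

lemma trivial_kernel_mono: "trivial_kernel J R \<Longrightarrow> R \<subseteq> S \<Longrightarrow> trivial_kernel J S"
  by (erule trivial_kernel_if_kernel_subset) (auto simp: kernel_def)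

lemma trivial_kernel_pivot:
  fixes R :: "('j \<Rightarrow> 'a::field) set"
  assumes "m \<in> J" "trivial_kernel J R"
  shows "\<exists>r\<in>R. r m \<noteq> 0"
proof (rule ccontr)
  assume no_pivot: "\<not> ?thesis"
  define unit where "unit j = (of_bool (j = m) :: 'a)" for j
  have "unit \<in> kernel J R"
    using no_pivot by (auto simp: kernel_def unit_def intro!: sum.neutral)
  with assms have "unit m = 0" unfolding trivial_kernel_def by blast
  then show False by (simp add: unit_def)
qed

lemma sum_eliminate_pivot:
  fixes c p r :: "'j \<Rightarrow> 'a::field"
  assumes "finite J" "m \<notin> J"
  shows "(\<Sum>j\<in>J. c j * (p m * r j - r m * p j)) =
    p m * (\<Sum>j\<in>insert m J. c j * r j) - r m * (\<Sum>j\<in>insert m J. c j * p j)"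
  using assms by (simp add: sum_subtractf sum_distrib_left algebra_simps)

lemma solve_for_pivot:
  fixes c p :: "'j \<Rightarrow> 'a::field"
  assumes "finite J" "m \<notin> J" "p m \<noteq> 0"
  obtains c' where "\<And>j. j \<in> J \<Longrightarrow> c' j = c j" "(\<Sum>j\<in>insert m J. c' j * p j) = b"
proof
  let ?c = "c(m := (b - (\<Sum>j\<in>J. c j * p j)) / p m)"
  show "?c j = c j" if "j \<in> J" for j
    using that assms(2) by auto
  then have "(\<Sum>j\<in>J. ?c j * p j) = (\<Sum>j\<in>J. c j * p j)" by (intro sum.cong) simp_all
  then show "(\<Sum>j\<in>insert m J. ?c j * p j) = b" using assms by simp
qed

lemma trivial_kernel_eliminate_pivot:
  fixes R :: "('j \<Rightarrow> 'a::field) set"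
  assumes index_set: "finite J" "m \<notin> J" and pivot: "p \<in> R" "p m \<noteq> 0"
  shows "trivial_kernel J ((\<lambda>r j. p m * r j - r m * p j) ` R) \<longleftrightarrow> trivial_kernel (insert m J) R"
    (is "trivial_kernel J (?e ` R) \<longleftrightarrow> _")
proof
  assume eliminated: "trivial_kernel J (?e ` R)"
  show "trivial_kernel (insert m J) R"
    unfolding trivial_kernel_def
  proof
    fix c assume in_kernel: "c \<in> kernel (insert m J) R"
    then have "c \<in> kernel J (?e ` R)"
      using pivot(1) by (simp add: kernel_def sum_eliminate_pivot[OF index_set])
    then have "c j = 0" if "j \<in> J" for j
      using eliminated that unfolding trivial_kernel_def by blast
    moreover have "(\<Sum>j\<in>insert m J. c j * p j) = 0"
      using in_kernel pivot(1) unfolding kernel_def by blast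
    ultimately show "\<forall>j\<in>insert m J. c j = 0" using index_set pivot(2) by simp
  qed
next
  assume trivial: "trivial_kernel (insert m J) R"
  show "trivial_kernel J (?e ` R)"
    unfolding trivial_kernel_def
  proof
    fix c assume in_kernel: "c \<in> kernel J (?e ` R)"
    obtain c' where c'_eq: "\<And>j. j \<in> J \<Longrightarrow> c' j = c j"
      and c'_pivot: "(\<Sum>j\<in>insert m J. c' j * p j) = 0"
      using solve_for_pivot[where p = p and b = 0, OF index_set pivot(2)] by blast
    have "(\<Sum>j\<in>insert m J. c' j * r j) = 0" if "r \<in> R" for r
    proof -
      have "0 = (\<Sum>j\<in>J. c j * ?e r j)" using in_kernel that by (auto simp: kernel_def)
      also have "\<dots> = (\<Sum>j\<in>J. c' j * ?e r j)" by (simp add: c'_eq)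
      finally show ?thesis using pivot(2) by (simp add: sum_eliminate_pivot[OF index_set] c'_pivot)
    qed
    then have "c' \<in> kernel (insert m J) R" by (simp add: kernel_def)
    then show "\<forall>j\<in>J. c j = 0" using trivial c'_eq by (auto simp: trivial_kernel_def)
  qed
qed

lemma generic_trivial_kernel:
  fixes R :: "(('v \<Rightarrow> 'a::field_char_0) \<Rightarrow> 'j \<Rightarrow> 'a) set"
  assumes "finite J" and "\<And>r j. r \<in> R \<Longrightarrow> j \<in> J \<Longrightarrow> poly_fun (\<lambda>w. r w j)"
    and "trivial_kernel J ((\<lambda>r. r w0) ` R)"
  shows "generic (\<lambda>w. trivial_kernel J ((\<lambda>r. r w) ` R))"
  using assms
proof (induction J arbitrary: R rule: finite_induct)
  case empty
  show ?case
    by (rule genericI[of "\<lambda>_. 1"]) (auto intro: poly_fun.intros simp: trivial_kernel_def)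
next
  case (insert m J)
  obtain p where pivot: "p \<in> R" "p w0 m \<noteq> 0"
    using trivial_kernel_pivot[OF insertI1 insert.prems(2)] by auto
  let ?e = "\<lambda>r w j. p w m * r w j - r w m * p w j"
  have eliminate: "trivial_kernel J ((\<lambda>r. r w) ` ?e ` R) \<longleftrightarrow>
      trivial_kernel (insert m J) ((\<lambda>r. r w) ` R)" if "p w m \<noteq> 0" for w
    using trivial_kernel_eliminate_pivot[of J m "p w" "(\<lambda>r. r w) ` R"] insert.hyps pivot(1) that
    by (simp add: image_image)
  have "generic (\<lambda>w. trivial_kernel J ((\<lambda>r. r w) ` ?e ` R))"
  proof (rule insert.IH)
    show "poly_fun (\<lambda>w. r w j)" if "r \<in> ?e ` R" "j \<in> J" for r j
      using that insert.prems(1) pivot(1) by (auto intro!: poly_fun_intros)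
    show "trivial_kernel J ((\<lambda>r. r w0) ` ?e ` R)"
      using eliminate pivot insert.prems(2) by blast
  qed
  moreover have "generic (\<lambda>w. p w m \<noteq> 0)"
    using insert.prems(1)[OF pivot(1), of m] pivot(2) by (intro genericI) auto
  ultimately have "generic (\<lambda>w. trivial_kernel J ((\<lambda>r. r w) ` ?e ` R) \<and> p w m \<noteq> 0)"
    by (rule generic_conj)
  then show ?case by (rule generic_mono) (use eliminate in blast)
qed

lemma trivial_kernel_solvable:
  fixes r :: "'i \<Rightarrow> 'j \<Rightarrow> 'a::field"
  assumes "finite J" "finite I" "card I = card J" "trivial_kernel J (r ` I)"
  shows "\<exists>c. \<forall>i\<in>I. (\<Sum>j\<in>J. c j * r i j) = b i"
  using assms
proof (induction J arbitrary: I r b rule: finite_induct)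
  case empty
  then show ?case by simp
next
  case (insert m J)
  obtain p where pivot: "p \<in> I" "r p m \<noteq> 0"
    using trivial_kernel_pivot[OF insertI1 insert.prems(3)] by auto
  let ?e = "\<lambda>i j. r p m * r i j - r i m * r p j"
  have "trivial_kernel J (?e ` I)"
    using trivial_kernel_eliminate_pivot[of J m "r p" "r ` I"] insert.hyps insert.prems(3) pivot
    by (simp add: image_image)
  then have "trivial_kernel J (?e ` (I - {p}))"
    by (rule trivial_kernel_if_kernel_subset) (auto simp: kernel_def)
  moreover have "card (I - {p}) = card J" using insert pivot by simp
  ultimately obtain c where eliminated: "\<And>i. i \<in> I - {p} \<Longrightarrow>
      (\<Sum>j\<in>J. c j * ?e i j) = r p m * b i - r i m * b p"
    using insert.IH[of "I - {p}" ?e "\<lambda>i. r p m * b i - r i m * b p"] insert.prems(1) by auto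
  obtain c' where c'_eq: "\<And>j. j \<in> J \<Longrightarrow> c' j = c j"
    and c'_pivot: "(\<Sum>j\<in>insert m J. c' j * r p j) = b p"
    using solve_for_pivot[where p = "r p" and b = "b p", OF insert.hyps pivot(2)] by blast
  have "(\<Sum>j\<in>insert m J. c' j * r i j) = b i" if "i \<in> I" for i
  proof (cases "i = p")
    case False
    then have "r p m * b i - r i m * b p = (\<Sum>j\<in>J. c' j * ?e i j)"
      using eliminated that by (simp add: c'_eq)
    then show ?thesis using pivot(2) by (simp add: sum_eliminate_pivot[OF insert.hyps] c'_pivot)
  qed (simp only: c'_pivot)
  then show ?case by blast
qed

section \<open>Forms and their monomials\<close>

definition mon :: "(nat \<Rightarrow> 'a::comm_semiring_1) \<Rightarrow> (nat \<Rightarrow> nat) \<Rightarrow> 'a" where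
  "mon x \<alpha> = (\<Prod>i<4. x i ^ \<alpha> i)"

lemma evalF_eq_sum_mon: "evalF d c x = (\<Sum>\<alpha>\<in>mons d. c \<alpha> * mon x \<alpha>)"
  by (simp add: evalF_def mon_def)

lemma lessThan_4: "{..<4::nat} = {0, 1, 2, 3}" by auto

lemma mon_eq: "mon x \<alpha> = x 0 ^ \<alpha> 0 * x 1 ^ \<alpha> 1 * x 2 ^ \<alpha> 2 * x 3 ^ \<alpha> 3"
  by (simp add: mon_def lessThan_4 mult.assoc)

lemma mons_iff: "\<alpha> \<in> mons d \<longleftrightarrow> (\<forall>i\<ge>4. \<alpha> i = 0) \<and> \<alpha> 0 + \<alpha> 1 + \<alpha> 2 + \<alpha> 3 = d"
  by (simp add: mons_def atLeast0LessThan lessThan_4 add.assoc)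

lemma mons_eqI: "\<alpha> \<in> mons d \<Longrightarrow> \<beta> \<in> mons d' \<Longrightarrow> (\<And>i. i < 4 \<Longrightarrow> \<alpha> i = \<beta> i) \<Longrightarrow> \<alpha> = \<beta>"
  by (rule ext) (metis mons_iff not_le)

lemma bij_betw_mons_lists:
  "bij_betw (\<lambda>\<alpha>. map \<alpha> [0..<4]) (mons d) {xs. length xs = 4 \<and> sum_list xs = d}"
proof (rule bij_betw_imageI)
  show "inj_on (\<lambda>\<alpha>. map \<alpha> [0..<4]) (mons d)"
    by (rule inj_onI) (erule (1) mons_eqI, simp)
  show "(\<lambda>\<alpha>. map \<alpha> [0..<4]) ` mons d = {xs. length xs = 4 \<and> sum_list xs = d}"
  proof (intro equalityI subsetI)
    fix xs :: "nat list" assume xs: "xs \<in> {xs. length xs = 4 \<and> sum_list xs = d}"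
    define \<alpha> where "\<alpha> i = (if i < 4 then xs ! i else 0)" for i
    have map_\<alpha>: "map \<alpha> [0..<4] = xs" using xs by (intro nth_equalityI) (auto simp: \<alpha>_def)
    then have "sum \<alpha> {0..<4} = d"
      using xs interv_sum_list_conv_sum_set_nat[of \<alpha> 0 4] by simp
    then have "\<alpha> \<in> mons d" by (simp add: mons_def \<alpha>_def)
    with map_\<alpha> show "xs \<in> (\<lambda>\<alpha>. map \<alpha> [0..<4]) ` mons d" by blast
  qed (auto simp: mons_def interv_sum_list_conv_sum_set_nat)
qed

lemma card_mons: "card (mons d) = (d + 3) choose 3"
proof -
  have "card (mons d) = (d + 4 - 1) choose d"
    using bij_betw_same_card[OF bij_betw_mons_lists] by (simp only: card_length_sum_list)
  also have "\<dots> = (d + 3) choose 3"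
    using binomial_symmetric[of d "d + 3"] by (simp add: add.commute)
  finally show ?thesis .
qed

lemma finite_mons: "finite (mons d)"
  by (rule card_ge_0_finite) (simp add: card_mons)

lemma evalF_scaled_sum: "evalF d (\<lambda>\<alpha>. \<Sum>i\<in>A. k i * g i \<alpha>) x = (\<Sum>i\<in>A. k i * evalF d (g i) x)"
  unfolding evalF_eq_sum_mon sum_distrib_left sum_distrib_right mult.assoc by (rule sum.swap)

lemma evalF_mon:
  fixes x :: "nat \<Rightarrow> 'a::field"
  assumes "\<gamma> \<in> mons d"
  shows "evalF d (\<lambda>\<alpha>. of_bool (\<alpha> = \<gamma>)) x = mon x \<gamma>"
  using assms
  by (simp add: evalF_eq_sum_mon finite_mons of_bool_def if_distrib[of "\<lambda>a. a * _"] cong: if_cong)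

lemma poly_fun_mon: "(\<And>m. poly_fun (\<lambda>z. X z m)) \<Longrightarrow> poly_fun (\<lambda>z. mon (X z) \<alpha>)"
  unfolding mon_def by (intro poly_fun_intros)

lemma poly_fun_evalF: "(\<And>m. poly_fun (\<lambda>z. X z m)) \<Longrightarrow> poly_fun (\<lambda>z. evalF d c (X z))"
  unfolding evalF_eq_sum_mon by (intro poly_fun_intros poly_fun_mon)

definition form_determining :: "nat \<Rightarrow> (nat \<Rightarrow> 'a::field) set \<Rightarrow> bool" where
  "form_determining d X \<longleftrightarrow> trivial_kernel (mons d) (mon ` X)"

lemma form_determining_iff:
  "form_determining d X \<longleftrightarrow> (\<forall>c. (\<forall>x\<in>X. evalF d c x = 0) \<longrightarrow> (\<forall>\<alpha>\<in>mons d. c \<alpha> = 0))"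
  by (auto simp: form_determining_def trivial_kernel_def kernel_def evalF_eq_sum_mon)

lemma form_determiningI:
  "(\<And>c \<alpha>. (\<And>x. x \<in> X \<Longrightarrow> evalF d c x = 0) \<Longrightarrow> \<alpha> \<in> mons d \<Longrightarrow> c \<alpha> = 0) \<Longrightarrow> form_determining d X"
  unfolding form_determining_iff by blast

lemma form_determiningD:
  "form_determining d X \<Longrightarrow> (\<And>x. x \<in> X \<Longrightarrow> evalF d c x = 0) \<Longrightarrow> \<alpha> \<in> mons d \<Longrightarrow> c \<alpha> = 0"
  unfolding form_determining_iff by blast

lemma form_determining_mono: "form_determining d X \<Longrightarrow> X \<subseteq> Y \<Longrightarrow> form_determining d Y"
  unfolding form_determining_iff by blast

lemma power_sum_identity:
  fixes c :: "'i \<Rightarrow> 'a::field_char_0"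
  assumes "finite S" "inj_on e S" "\<And>t. (\<Sum>i\<in>S. c i * t ^ e i) = 0" "k \<in> S"
  shows "c k = 0"
proof -
  define p where "p = (\<Sum>i\<in>S. monom (c i) (e i))"
  have "poly p t = 0" for t
    using assms(3)[of t] by (simp add: p_def poly_sum poly_monom)
  then have "p = 0" using poly_all_0_iff_0 by blast
  then have "0 = coeff p (e k)" by simp
  also have "\<dots> = (\<Sum>i\<in>S. if i = k then c i else 0)"
    unfolding p_def coeff_sum coeff_monom
    by (rule sum.cong) (use assms(2,4) in \<open>auto simp: inj_on_def\<close>)
  also have "\<dots> = c k" using assms(1,4) by simp
  finally show ?thesis by simp
qed

lemma base_digits_unique:
  fixes a b :: nat
  assumes "a < n" "b < n" "a + n * x = b + n * y"
  shows "a = b" "x = y"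
proof -
  have "a = (a + n * x) mod n" using assms(1) by simp
  also have "\<dots> = b" using assms(2,3) by simp
  finally show "a = b" .
  then show "x = y" using assms by simp
qed

lemma inj_on_digits_mons:
  assumes "d < n"
  shows "inj_on (\<lambda>\<alpha>. \<alpha> 0 + n * (\<alpha> 1 + n * (\<alpha> 2 + n * \<alpha> 3))) (mons d)"
proof (rule inj_onI)
  fix \<alpha> \<beta> assume mons: "\<alpha> \<in> mons d" "\<beta> \<in> mons d"
    and digits: "\<alpha> 0 + n * (\<alpha> 1 + n * (\<alpha> 2 + n * \<alpha> 3)) = \<beta> 0 + n * (\<beta> 1 + n * (\<beta> 2 + n * \<beta> 3))"
  have less: "\<alpha> 0 < n" "\<beta> 0 < n" "\<alpha> 1 < n" "\<beta> 1 < n" "\<alpha> 2 < n" "\<beta> 2 < n"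
    using mons assms unfolding mons_iff by linarith+
  note digit0 = base_digits_unique[OF less(1,2) digits]
  note digit1 = base_digits_unique[OF less(3,4) digit0(2)]
  note digit2 = base_digits_unique[OF less(5,6) digit1(2)]
  have "\<forall>i<4. \<alpha> i = \<beta> i"
    using digit0(1) digit1(1) digit2 by (simp add: numeral_eq_Suc All_less_Suc)
  then show "\<alpha> = \<beta>" by (intro mons_eqI[OF mons]) blast
qed

text \<open>Kronecker substitution: on the curve \<open>(t, t^n, t^n^2, t^n^3)\<close> distinct monomials of
  degree less than \<open>n\<close> become distinct powers of \<open>t\<close>.\<close>
lemma form_determining_UNIV: "form_determining d (UNIV :: (nat \<Rightarrow> 'a::field_char_0) set)"
proof (rule form_determiningI)
  fix c :: "(nat \<Rightarrow> nat) \<Rightarrow> 'a" and \<alpha>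
  assume zero: "\<And>x. x \<in> UNIV \<Longrightarrow> evalF d c x = 0" and \<alpha>: "\<alpha> \<in> mons d"
  let ?n = "Suc d"
  let ?e = "\<lambda>\<alpha>. \<alpha> 0 + ?n * (\<alpha> 1 + ?n * (\<alpha> 2 + ?n * \<alpha> (3::nat)))"
  have "mon (\<lambda>i. t ^ (?n ^ i)) \<alpha> = t ^ ?e \<alpha>" for t :: 'a and \<alpha>
    by (simp add: mon_eq power_add power_mult[symmetric] power2_eq_square power3_eq_cube
        algebra_simps)
  then have "(\<Sum>\<alpha>\<in>mons d. c \<alpha> * t ^ ?e \<alpha>) = 0" for t
    using zero[of "\<lambda>i. t ^ (?n ^ i)"] by (simp add: evalF_eq_sum_mon)
  then show "c \<alpha> = 0"
    using power_sum_identity[OF finite_mons inj_on_digits_mons _ \<alpha>, of ?n c] by simp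
qed

section \<open>Restriction to a quadric\<close>

text \<open>An affine chart of the Segre embedding of the quadric \<open>x\<^sub>0 x\<^sub>3 = x\<^sub>1 x\<^sub>2\<close>; the curves of
  constant first (or second) coordinate are the lines of the two rulings.\<close>
definition seg :: "'a::comm_semiring_1 \<times> 'a \<Rightarrow> nat \<Rightarrow> 'a" where
  "seg P m = (if m = 0 then 1 else if m = 1 then snd P else if m = 2 then fst P else fst P * snd P)"

lemma poly_fun_seg:
  assumes "poly_fun (\<lambda>z. fst (P z))" "poly_fun (\<lambda>z. snd (P z))"
  shows "poly_fun (\<lambda>z. seg (P z) m)"
  using assms
  by (cases "m = 0"; cases "m = 1"; cases "m = 2") (simp_all add: seg_def poly_fun.intros)

definition quadric :: "(nat \<Rightarrow> 'a::field) \<Rightarrow> 'a" where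
  "quadric x = x 0 * x 3 - x 1 * x 2"

definition bidegree :: "(nat \<Rightarrow> nat) \<Rightarrow> nat \<times> nat" where
  "bidegree \<alpha> = (\<alpha> 2 + \<alpha> 3, \<alpha> 1 + \<alpha> 3)"

definition bimon :: "'a::comm_semiring_1 \<times> 'a \<Rightarrow> nat \<times> nat \<Rightarrow> 'a" where
  "bimon P q = fst P ^ fst q * snd P ^ snd q"

lemma mon_seg: "mon (seg P) \<alpha> = bimon P (bidegree \<alpha>)"
  by (simp add: mon_eq seg_def bimon_def bidegree_def power_add power_mult_distrib algebra_simps)

definition quadric_trace :: "nat \<Rightarrow> ((nat \<Rightarrow> nat) \<Rightarrow> 'a::field) \<Rightarrow> nat \<times> nat \<Rightarrow> 'a" where
  "quadric_trace d c q = (\<Sum>\<alpha> | \<alpha> \<in> mons d \<and> bidegree \<alpha> = q. c \<alpha>)"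

lemma bidegree_mons: "\<alpha> \<in> mons d \<Longrightarrow> bidegree \<alpha> \<in> {..d} \<times> {..d}"
  by (auto simp: mons_iff bidegree_def)

lemma sum_quadric_trace:
  "(\<Sum>q\<in>{..d} \<times> {..d}. quadric_trace d c q * r q) = (\<Sum>\<alpha>\<in>mons d. c \<alpha> * r (bidegree \<alpha>))"
proof -
  have "(\<Sum>q\<in>{..d} \<times> {..d}. quadric_trace d c q * r q)
    = (\<Sum>q\<in>{..d} \<times> {..d}. \<Sum>\<alpha> | \<alpha> \<in> mons d \<and> bidegree \<alpha> = q. c \<alpha> * r (bidegree \<alpha>))"
    unfolding quadric_trace_def sum_distrib_right by (intro sum.cong) auto
  also have "\<dots> = (\<Sum>\<alpha>\<in>mons d. c \<alpha> * r (bidegree \<alpha>))"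
    by (rule sum.group) (use finite_mons bidegree_mons in blast)+
  finally show ?thesis .
qed

lemma mon_exchange_mod_quadric:
  fixes d n a\<^sub>0 b\<^sub>1 b\<^sub>2 a\<^sub>3 :: nat
  assumes "a\<^sub>0 + b\<^sub>1 + b\<^sub>2 + a\<^sub>3 + 2 * n = d + 2"
  shows "\<exists>g. \<forall>x :: nat \<Rightarrow> 'a::field. x 0 ^ (a\<^sub>0 + n) * x 1 ^ b\<^sub>1 * x 2 ^ b\<^sub>2 * x 3 ^ (a\<^sub>3 + n) =
    x 0 ^ a\<^sub>0 * x 1 ^ (b\<^sub>1 + n) * x 2 ^ (b\<^sub>2 + n) * x 3 ^ a\<^sub>3 + quadric x * evalF d g x"
proof -
  define \<gamma> where "\<gamma> q = (\<lambda>_ :: nat. 0)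
    (0 := a\<^sub>0 + q, 1 := b\<^sub>1 + (n - Suc q), 2 := b\<^sub>2 + (n - Suc q), 3 := a\<^sub>3 + q)" for q :: nat
  define g where "g \<alpha> = (\<Sum>q<n. 1 * of_bool (\<alpha> = \<gamma> q) :: 'a)" for \<alpha>
  have \<gamma>_mons: "\<gamma> q \<in> mons d" if "q < n" for q
    using that assms by (simp add: mons_iff \<gamma>_def)
  show ?thesis
  proof (intro exI[of _ g] allI)
    fix x :: "nat \<Rightarrow> 'a"
    let ?rest = "x 0 ^ a\<^sub>0 * x 1 ^ b\<^sub>1 * x 2 ^ b\<^sub>2 * x 3 ^ a\<^sub>3"
    have "evalF d g x = (\<Sum>q<n. mon x (\<gamma> q))"
      unfolding g_def evalF_scaled_sum by (simp add: evalF_mon[OF \<gamma>_mons])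
    also have "\<dots> = ?rest * (\<Sum>q<n. (x 1 * x 2) ^ (n - Suc q) * (x 0 * x 3) ^ q)"
      unfolding sum_distrib_left
      by (intro sum.cong)
        (simp_all add: mon_eq \<gamma>_def power_add power_mult_distrib mult_ac del: Nat.add_diff_assoc)
    finally have "quadric x * evalF d g x = ?rest * ((x 0 * x 3) ^ n - (x 1 * x 2) ^ n)"
      unfolding power_diff_sumr2 by (simp only: quadric_def mult.left_commute)
    then show "x 0 ^ (a\<^sub>0 + n) * x 1 ^ b\<^sub>1 * x 2 ^ b\<^sub>2 * x 3 ^ (a\<^sub>3 + n) =
        x 0 ^ a\<^sub>0 * x 1 ^ (b\<^sub>1 + n) * x 2 ^ (b\<^sub>2 + n) * x 3 ^ a\<^sub>3 + quadric x * evalF d g x"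
      by (simp add: power_add power_mult_distrib algebra_simps)
  qed
qed

text \<open>Monomials of equal bidegree differ by exchanging a power of \<open>x\<^sub>0 x\<^sub>3\<close> for one of \<open>x\<^sub>1 x\<^sub>2\<close>.\<close>
lemma mon_mod_quadric:
  fixes \<alpha> \<beta> :: "nat \<Rightarrow> nat"
  assumes "\<alpha> \<in> mons (d + 2)" "\<beta> \<in> mons (d + 2)" "bidegree \<alpha> = bidegree \<beta>"
  shows "\<exists>g. \<forall>x. mon x \<alpha> = mon x \<beta> + quadric x * evalF d g (x :: nat \<Rightarrow> 'a::field)"
proof (cases "\<beta> 3 \<le> \<alpha> 3")
  case True
  define n where "n = \<alpha> 3 - \<beta> 3"
  have "\<alpha> 3 = \<beta> 3 + n" "\<alpha> 0 = \<beta> 0 + n" "\<beta> 1 = \<alpha> 1 + n" "\<beta> 2 = \<alpha> 2 + n"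
    using assms True by (auto simp: mons_iff bidegree_def n_def)
  moreover from this assms(1) have "\<beta> 0 + \<alpha> 1 + \<alpha> 2 + \<beta> 3 + 2 * n = d + 2"
    by (simp add: mons_iff)
  ultimately show ?thesis using mon_exchange_mod_quadric by (simp add: mon_eq)
next
  case False
  define n where "n = \<beta> 3 - \<alpha> 3"
  have exponents: "\<beta> 3 = \<alpha> 3 + n" "\<beta> 0 = \<alpha> 0 + n" "\<alpha> 1 = \<beta> 1 + n" "\<alpha> 2 = \<beta> 2 + n"
    using assms False by (auto simp: mons_iff bidegree_def n_def)
  with assms(2) have "\<alpha> 0 + \<beta> 1 + \<beta> 2 + \<alpha> 3 + 2 * n = d + 2" by (simp add: mons_iff)
  from mon_exchange_mod_quadric[OF this, where 'a = 'a] obtain g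
    where "\<forall>x. mon x \<beta> = mon x \<alpha> + quadric x * evalF d g (x :: nat \<Rightarrow> 'a)"
    by (auto simp: mon_eq exponents simp del: One_nat_def)
  moreover have "evalF d (\<lambda>\<gamma>. - g \<gamma>) x = - evalF d g x" for x
    by (simp add: evalF_eq_sum_mon sum_negf)
  ultimately show ?thesis by (intro exI[of _ "\<lambda>\<gamma>. - g \<gamma>"]) simp
qed

lemma quadric_divides:
  fixes c :: "(nat \<Rightarrow> nat) \<Rightarrow> 'a::field"
  assumes "\<And>q. q \<in> {..d + 2} \<times> {..d + 2} \<Longrightarrow> quadric_trace (d + 2) c q = 0"
  shows "\<exists>g. \<forall>x. evalF (d + 2) c x = quadric x * evalF d g x"
proof -
  define rep where "rep q = (SOME \<beta>. \<beta> \<in> mons (d + 2) \<and> bidegree \<beta> = q)" for q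
  have rep: "rep (bidegree \<alpha>) \<in> mons (d + 2)" "bidegree (rep (bidegree \<alpha>)) = bidegree \<alpha>"
    if "\<alpha> \<in> mons (d + 2)" for \<alpha>
    using someI[of "\<lambda>\<beta>. \<beta> \<in> mons (d + 2) \<and> bidegree \<beta> = bidegree \<alpha>" \<alpha>] that
    by (auto simp: rep_def)
  have "\<forall>\<alpha>\<in>mons (d + 2). \<exists>g. \<forall>x :: nat \<Rightarrow> 'a.
      mon x \<alpha> = mon x (rep (bidegree \<alpha>)) + quadric x * evalF d g x"
    using mon_mod_quadric rep by metis
  from bchoice[OF this] obtain g where mon_mod: "\<And>\<alpha> x :: nat \<Rightarrow> 'a. \<alpha> \<in> mons (d + 2) \<Longrightarrow>
      mon x \<alpha> = mon x (rep (bidegree \<alpha>)) + quadric x * evalF d (g \<alpha>) x" by blast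
  have "evalF (d + 2) c x = quadric x * evalF d (\<lambda>\<beta>. \<Sum>\<alpha>\<in>mons (d + 2). c \<alpha> * g \<alpha> \<beta>) x" for x
  proof -
    have "evalF (d + 2) c x = (\<Sum>\<alpha>\<in>mons (d + 2). c \<alpha> * mon x (rep (bidegree \<alpha>)))
      + (\<Sum>\<alpha>\<in>mons (d + 2). quadric x * (c \<alpha> * evalF d (g \<alpha>) x))"
      unfolding evalF_eq_sum_mon[of "d + 2"] sum.distrib[symmetric]
      by (rule sum.cong) (simp_all add: mon_mod distrib_left mult.left_commute)
    also have "(\<Sum>\<alpha>\<in>mons (d + 2). c \<alpha> * mon x (rep (bidegree \<alpha>))) = 0"
      using assms by (simp flip: sum_quadric_trace[where r = "\<lambda>q. mon x (rep q)"])
    finally show ?thesis by (simp add: evalF_scaled_sum sum_distrib_left)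
  qed
  then show ?thesis by blast
qed

type_synonym 'a secant = "('a \<times> 'a) \<times> ('a \<times> 'a)"

definition chord :: "'a::comm_ring_1 \<times> 'a \<Rightarrow> 'a \<times> 'a \<Rightarrow> (nat \<Rightarrow> 'a) set" where
  "chord P Q = range (\<lambda>(s, t) m. s * seg P m + t * seg Q m)"

definition chords :: "'a::comm_ring_1 secant set \<Rightarrow> (nat \<Rightarrow> 'a) set" where
  "chords L = (\<Union>(P, Q)\<in>L. chord P Q)"

definition transversal :: "'a \<times> 'a \<Rightarrow> 'a \<times> 'a \<Rightarrow> bool" where
  "transversal P Q \<longleftrightarrow> fst P \<noteq> fst Q \<and> snd P \<noteq> snd Q"

lemma chordI: "(\<lambda>m. s * seg P m + t * seg Q m) \<in> chord P Q"
  unfolding chord_def by (rule range_eqI[of _ _ "(s, t)"]) simp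

lemma chords_Un: "chords (L \<union> L') = chords L \<union> chords L'"
  by (auto simp: chords_def)

lemma chords_mono: "L \<subseteq> L' \<Longrightarrow> chords L \<subseteq> chords L'"
  unfolding chords_def by blast

lemma chords_image:
  fixes f :: "'b \<Rightarrow> 'a::comm_ring_1 secant"
  shows "chords (f ` A) = (\<lambda>(x, s, t) m. s * seg (fst (f x)) m + t * seg (snd (f x)) m) ` (A \<times> UNIV)"
proof -
  have "(\<Union>x\<in>A. range (h x)) = case_prod h ` (A \<times> UNIV)"
    for h :: "'b \<Rightarrow> 'a \<times> 'a \<Rightarrow> nat \<Rightarrow> 'a" by auto
  then show ?thesis by (simp add: chords_def chord_def split_def)
qed

lemma chord_subset_chords: "(P, Q) \<in> L \<Longrightarrow> chord P Q \<subseteq> chords L"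
  by (auto simp: chords_def)

lemma chord_ends: "seg P \<in> chord P Q" "seg Q \<in> chord P Q"
  using chordI[of 1 P 0 Q] chordI[of 0 P 1 Q] by simp_all

lemma chord_commute: "chord P Q = chord Q P"
proof -
  have "chord P Q \<subseteq> chord Q P" for P Q :: "'a \<times> 'a"
  proof
    fix x assume "x \<in> chord P Q"
    then obtain s t where "x = (\<lambda>m. t * seg Q m + s * seg P m)"
      by (auto simp: chord_def add.commute)
    then show "x \<in> chord Q P" by (simp only: chordI)
  qed
  then show ?thesis by blast
qed

lemma chord_subset_chords_symcl: "(P, Q) \<in> L \<union> L\<inverse> \<Longrightarrow> chord P Q \<subseteq> chords L"
  using chord_subset_chords[of P Q] chord_subset_chords[of Q P] chord_commute[of P Q] by auto

lemma seg_mem_ruling: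
  fixes a b b' b'' :: "'a::field"
  assumes "b \<noteq> b'"
  shows "seg (a, b'') \<in> chord (a, b) (a, b')"
proof -
  define t where "t = (b'' - b) / (b' - b)"
  have "t * (b' - b) = b'' - b" using assms by (simp add: t_def)
  then have "b'' = (1 - t) * b + t * b'" by (simp add: algebra_simps)
  then have "seg (a, b'') = (\<lambda>m. (1 - t) * seg (a, b) m + t * seg (a, b') m)"
    by (intro ext) (simp add: seg_def algebra_simps flip: distrib_left)
  then show ?thesis using chordI by metis
qed

lemma vanishes_on_chord_if_quadric_multiple_does:
  fixes P Q :: "'a::field_char_0 \<times> 'a"
  assumes "transversal P Q" "\<And>x. x \<in> chord P Q \<Longrightarrow> quadric x * evalF d g x = 0"
    and "x \<in> chord P Q"
  shows "evalF d g x = 0"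
proof -
  let ?point = "\<lambda>z m. z True * seg P m + z False * seg Q m"
  obtain s t where x_eq: "x = ?point (\<lambda>b. if b then s else t)"
    using assms(3) by (auto simp: chord_def)
  have "quadric (?point z) = z True * z False * ((fst P - fst Q) * (snd P - snd Q))" for z
    by (simp add: quadric_def seg_def algebra_simps)
  then have zero_off_ends: "evalF d g (?point z) = 0" if "z True * z False \<noteq> 0" for z
    using assms(1) assms(2)[OF chordI, of "z True" "z False"] that by (simp add: transversal_def)
  have poly: "poly_fun (\<lambda>z. evalF d g (?point z))" "poly_fun (\<lambda>z. z True * z False :: 'a)"
    by (intro poly_fun_evalF poly_fun_intros)+
  show ?thesis
    unfolding x_eq
    by (rule poly_fun_eq_0_if_eq_0_off_zeros[OF poly, of "\<lambda>_. 1"]) (use zero_off_ends in simp_all)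
qed

text \<open>\<open>R\<close> consists of conditions on bihomogeneous forms; composition with \<open>bidegree\<close> turns them into
  conditions on the restriction of a form to the quadric.\<close>
lemma castelnuovo:
  fixes L :: "'a::field_char_0 secant set"
  assumes trace: "trivial_kernel ({..d + 2} \<times> {..d + 2}) R"
    and residual: "form_determining d (chords L)"
    and transversal: "\<And>P Q. (P, Q) \<in> L \<Longrightarrow> transversal P Q"
  shows "trivial_kernel (mons (d + 2)) (mon ` chords L \<union> (\<lambda>r. r \<circ> bidegree) ` R)"
  unfolding trivial_kernel_def
proof
  fix c assume in_kernel: "c \<in> kernel (mons (d + 2)) (mon ` chords L \<union> (\<lambda>r. r \<circ> bidegree) ` R)"
  then have "quadric_trace (d + 2) c \<in> kernel ({..d + 2} \<times> {..d + 2}) R"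
    by (simp add: kernel_def ball_Un sum_quadric_trace)
  with trace have "quadric_trace (d + 2) c q = 0" if "q \<in> {..d + 2} \<times> {..d + 2}" for q
    using that unfolding trivial_kernel_def by blast
  from quadric_divides[OF this] obtain g
    where multiple: "\<And>x. evalF (d + 2) c x = quadric x * evalF d g x" by blast
  have "evalF (d + 2) c x = 0" if "x \<in> chords L" for x
    using in_kernel that by (simp add: kernel_def ball_Un evalF_eq_sum_mon)
  then have "evalF d g x = 0" if "x \<in> chords L" for x
    using that transversal unfolding multiple chords_def
    by (force intro: vanishes_on_chord_if_quadric_multiple_does)
  then have "g \<alpha> = 0" if "\<alpha> \<in> mons d" for \<alpha>
    using form_determiningD[OF residual _ that] by blast
  then have "evalF (d + 2) c x = 0" for x unfolding multiple by (simp add: evalF_eq_sum_mon)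
  then show "\<forall>\<alpha>\<in>mons (d + 2). c \<alpha> = 0"
    using form_determiningD[OF form_determining_UNIV] by blast
qed

section \<open>Bihomogeneous forms with simple and double zeros\<close>

lemma pderiv_sum: "pderiv (\<Sum>i\<in>A. f i) = (\<Sum>i\<in>A. pderiv (f i))"
  using higher_pderiv_sum[of 1] by simp

lemma poly_eq_0_if_double_roots:
  fixes p :: "'a::field_char_0 poly"
  assumes "finite Z" "D \<subseteq> Z" "\<And>z. z \<in> Z \<Longrightarrow> poly p z = 0"
    and "\<And>z. z \<in> D \<Longrightarrow> poly (pderiv p) z = 0"
    and "degree p < card Z + card D"
  shows "p = 0"
proof (rule ccontr)
  assume "p \<noteq> 0"
  have finite_D: "finite D" using assms(1,2) finite_subset by blast
  have simple: "1 \<le> order z p" if "z \<in> Z" for z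
    using assms(3)[OF that] \<open>p \<noteq> 0\<close> order_root[of p z] by simp
  have double: "2 \<le> order z p" if "z \<in> D" for z
  proof -
    have root: "poly p z = 0" using that assms(2,3) by blast
    have "pderiv p \<noteq> 0"
    proof
      assume "pderiv p = 0"
      then obtain h where "p = [:h:]" using pderiv_iszero by blast
      with root \<open>p \<noteq> 0\<close> show False by simp
    qed
    then show ?thesis
      using order_pderiv[OF \<open>p \<noteq> 0\<close> root] assms(4)[OF that] order_root[of "pderiv p" z] by simp
  qed
  have "count (mset_set Z + mset_set D) z \<le> count (proots p) z" for z
    using simple[of z] double[of z] \<open>p \<noteq> 0\<close> assms(1,2) finite_D by (auto simp: count_mset_set')
  then have "mset_set Z + mset_set D \<subseteq># proots p" by (rule mset_subset_eqI)
  then have "card Z + card D \<le> size (proots p)" using size_mset_mono by fastforce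
  then show False using size_proots_le[of p] assms(5) by simp
qed

lemma coeffs_eq_0_if_double_zeros:
  fixes f :: "nat \<Rightarrow> 'a::field_char_0"
  assumes "finite Z" "D \<subseteq> Z" and "\<And>z. z \<in> Z \<Longrightarrow> (\<Sum>i\<le>d. f i * z ^ i) = 0"
    and "\<And>z. z \<in> D \<Longrightarrow> (\<Sum>i\<le>d. f i * (of_nat i * z ^ (i - 1))) = 0"
    and "d < card Z + card D" and "i \<le> d"
  shows "f i = 0"
proof -
  define p where "p = (\<Sum>i\<le>d. monom (f i) i)"
  have poly_p: "poly p z = (\<Sum>i\<le>d. f i * z ^ i)" for z
    by (simp add: p_def poly_sum poly_monom)
  have poly_pderiv_p: "poly (pderiv p) z = (\<Sum>i\<le>d. f i * (of_nat i * z ^ (i - 1)))" for z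
    by (simp add: p_def pderiv_sum pderiv_monom poly_sum poly_monom mult_ac)
  have "degree p \<le> d"
    unfolding p_def by (intro degree_sum_le) (auto intro: order_trans[OF degree_monom_le])
  then have "p = 0"
    using assms
    by (intro poly_eq_0_if_double_roots[OF assms(1,2)]) (auto simp: poly_p poly_pderiv_p)
  then have "coeff p i = 0" by simp
  moreover have "coeff p i = (\<Sum>j\<le>d. if j = i then f j else 0)"
    by (simp add: p_def coeff_sum)
  ultimately show ?thesis using assms(6) by simp
qed

definition bimon_da :: "'a::comm_semiring_1 \<times> 'a \<Rightarrow> nat \<times> nat \<Rightarrow> 'a" where
  "bimon_da P q = of_nat (fst q) * fst P ^ (fst q - 1) * snd P ^ snd q"

definition bimon_db :: "'a::comm_semiring_1 \<times> 'a \<Rightarrow> nat \<times> nat \<Rightarrow> 'a" where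
  "bimon_db P q = bimon_da (prod.swap P) (prod.swap q)"

definition biform :: "nat \<Rightarrow> (nat \<times> nat \<Rightarrow> 'a::field) \<Rightarrow> 'a \<times> 'a \<Rightarrow> 'a" where
  "biform d e P = (\<Sum>q\<in>{..d} \<times> {..d}. e q * bimon P q)"

definition biform_da :: "nat \<Rightarrow> (nat \<times> nat \<Rightarrow> 'a::field) \<Rightarrow> 'a \<times> 'a \<Rightarrow> 'a" where
  "biform_da d e P = (\<Sum>q\<in>{..d} \<times> {..d}. e q * bimon_da P q)"

definition biform_db :: "nat \<Rightarrow> (nat \<times> nat \<Rightarrow> 'a::field) \<Rightarrow> 'a \<times> 'a \<Rightarrow> 'a" where
  "biform_db d e P = (\<Sum>q\<in>{..d} \<times> {..d}. e q * bimon_db P q)"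

lemma sum_square_swap: "(\<Sum>q\<in>{..d} \<times> {..d}. h (prod.swap q)) = (\<Sum>q\<in>{..d} \<times> {..d :: nat}. h q)"
  by (rule sum.reindex_bij_witness[of _ prod.swap prod.swap]) auto

lemma biform_swap: "biform d (e \<circ> prod.swap) (prod.swap P) = biform d e P"
  unfolding biform_def using sum_square_swap[of "\<lambda>q. e q * bimon P q" d]
  by (simp add: bimon_def mult.commute)

lemma biform_db_swap: "biform_db d (e \<circ> prod.swap) (prod.swap P) = biform_da d e P"
  unfolding biform_db_def biform_da_def using sum_square_swap[of "\<lambda>q. e q * bimon_da P q" d]
  by (simp add: bimon_db_def)

lemma biform_eq_sum_powers:
  "biform d e (a, b) = (\<Sum>j\<le>d. (\<Sum>i\<le>d. e (i, j) * a ^ i) * b ^ j)"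
  "biform_db d e (a, b) = (\<Sum>j\<le>d. (\<Sum>i\<le>d. e (i, j) * a ^ i) * (of_nat j * b ^ (j - 1)))"
proof -
  have iterate: "(\<Sum>q\<in>{..d} \<times> {..d}. h q) = (\<Sum>j\<le>d. \<Sum>i\<le>d. h (i, j))" for h :: "nat \<times> nat \<Rightarrow> 'a"
    using sum.swap[of "\<lambda>i j. h (i, j)"] by (simp add: sum.cartesian_product)
  show "biform d e (a, b) = (\<Sum>j\<le>d. (\<Sum>i\<le>d. e (i, j) * a ^ i) * b ^ j)"
    "biform_db d e (a, b) = (\<Sum>j\<le>d. (\<Sum>i\<le>d. e (i, j) * a ^ i) * (of_nat j * b ^ (j - 1)))"
    unfolding biform_def biform_db_def iterate sum_distrib_right
    by (intro sum.cong refl; simp add: bimon_def bimon_db_def bimon_da_def mult_ac)+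
qed

lemma biform_column_coeffs_eq_0:
  fixes e :: "nat \<times> nat \<Rightarrow> 'a::field_char_0"
  assumes "finite Z" "D \<subseteq> Z" "\<And>n. n \<in> Z \<Longrightarrow> biform d e (a, of_nat n) = 0"
    and "\<And>n. n \<in> D \<Longrightarrow> biform_db d e (a, of_nat n) = 0" and "d < card Z + card D" and "j \<le> d"
  shows "(\<Sum>i\<le>d. e (i, j) * a ^ i) = 0"
proof (rule coeffs_eq_0_if_double_zeros[of "of_nat ` Z" "of_nat ` D" "\<lambda>j. \<Sum>i\<le>d. e (i, j) * a ^ i" d])
  have "card (of_nat ` A :: 'a set) = card A" for A :: "nat set"
    by (simp add: card_image inj_on_def)
  then show "d < card (of_nat ` Z :: 'a set) + card (of_nat ` D :: 'a set)"
    using assms(5) by simp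
qed (use assms in \<open>auto simp: biform_eq_sum_powers\<close>)

lemma biform_column_eq_0:
  fixes e :: "nat \<times> nat \<Rightarrow> 'a::field_char_0"
  assumes "finite Z" "D \<subseteq> Z" "\<And>n. n \<in> Z \<Longrightarrow> biform d e (a, of_nat n) = 0"
    and "\<And>n. n \<in> D \<Longrightarrow> biform_db d e (a, of_nat n) = 0" and "d < card Z + card D"
  shows "biform d e (a, b) = 0"
  using biform_column_coeffs_eq_0[OF assms] by (simp add: biform_eq_sum_powers)

lemma biform_row_eq_0:
  fixes e :: "nat \<times> nat \<Rightarrow> 'a::field_char_0"
  assumes "finite Z" "D \<subseteq> Z" "\<And>n. n \<in> Z \<Longrightarrow> biform d e (of_nat n, b) = 0"
    and "\<And>n. n \<in> D \<Longrightarrow> biform_da d e (of_nat n, b) = 0" and "d < card Z + card D"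
  shows "biform d e (a, b) = 0"
proof -
  have "biform d (e \<circ> prod.swap) (b, a) = 0"
    by (rule biform_column_eq_0[OF assms(1,2) _ _ assms(5)])
      (use assms(3,4) biform_swap[of d e "(_, b)"] biform_db_swap[of d e "(_, b)"] in simp_all)
  then show ?thesis using biform_swap[of d e "(a, b)"] by simp
qed

lemma biform_coeff_eq_0_if_columns_eq_0:
  fixes e :: "nat \<times> nat \<Rightarrow> 'a::field_char_0"
  assumes columns: "\<And>i b. i \<le> d \<Longrightarrow> biform d e (of_nat i, b) = 0" and q: "q \<in> {..d} \<times> {..d}"
  shows "e q = 0"
proof -
  have "biform d e (a, b) = 0" for a b
    by (rule biform_row_eq_0[of "{..d}" "{}"]) (use columns in auto)
  then have "(\<Sum>i\<le>d. e (i, snd q) * a ^ i) = 0" for a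
    by (intro biform_column_coeffs_eq_0[of "{..d}" "{}"]) (use q in auto)
  then have "e (fst q, snd q) = 0"
    using q coeffs_eq_0_if_double_zeros[of "of_nat ` {..d}" "{}" "\<lambda>i. e (i, snd q)" d "fst q"]
    by (auto simp: card_image inj_on_def)
  then show ?thesis by simp
qed

definition biform_determining :: "nat \<Rightarrow> ('a::field \<times> 'a) set \<Rightarrow> ('a \<times> 'a) set \<Rightarrow> bool" where
  "biform_determining d T D \<longleftrightarrow>
     trivial_kernel ({..d} \<times> {..d}) (bimon ` T \<union> (bimon_da ` D \<union> bimon_db ` D))"

lemma biform_determiningI:
  assumes "\<And>e q. (\<And>P. P \<in> T \<Longrightarrow> biform d e P = 0) \<Longrightarrow> (\<And>P. P \<in> D \<Longrightarrow> biform_da d e P = 0) \<Longrightarrow>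
    (\<And>P. P \<in> D \<Longrightarrow> biform_db d e P = 0) \<Longrightarrow> q \<in> {..d} \<times> {..d} \<Longrightarrow> e q = 0"
  shows "biform_determining d T D"
  unfolding biform_determining_def trivial_kernel_def
proof (intro ballI)
  fix e q
  assume "e \<in> kernel ({..d} \<times> {..d}) (bimon ` T \<union> (bimon_da ` D \<union> bimon_db ` D))"
    and "q \<in> {..d} \<times> {..d}"
  then show "e q = 0"
    by (intro assms[of e q]) (auto simp: kernel_def ball_Un biform_def biform_da_def biform_db_def)
qed

abbreviation nat_point :: "nat \<times> nat \<Rightarrow> 'a::semiring_1 \<times> 'a" where
  "nat_point \<equiv> map_prod of_nat of_nat"

abbreviation nat_columns :: "nat set \<Rightarrow> ('a::semiring_1 \<times> 'a) set" where
  "nat_columns I \<equiv> of_nat ` I \<times> UNIV"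

lemma biform_determining_grid:
  fixes T :: "('a::field_char_0 \<times> 'a) set"
  assumes "nat_columns {u..d} \<subseteq> T" "nat_point ` ({..<u} \<times> {..d}) \<subseteq> T"
  shows "biform_determining d T {}"
proof (rule biform_determiningI)
  fix e :: "nat \<times> nat \<Rightarrow> 'a" and q
  assume zero: "\<And>P. P \<in> T \<Longrightarrow> biform d e P = 0" and q: "q \<in> {..d} \<times> {..d}"
  have "biform d e (of_nat i, b) = 0" if "i \<le> d" for i b
  proof (cases "i < u")
    case True
    have points: "biform d e (nat_point (i, j)) = 0" if "j \<le> d" for j
      by (rule zero) (use assms(2) True that in blast)
    show ?thesis by (rule biform_column_eq_0[of "{..d}" "{}"]) (use points in auto)
  next
    case False
    then have "(of_nat i, b) \<in> T" using assms(1) that by auto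
    then show ?thesis by (rule zero)
  qed
  then show "e q = 0" using biform_coeff_eq_0_if_columns_eq_0 q by blast
qed

definition double_node :: "nat \<Rightarrow> nat \<times> bool \<Rightarrow> nat \<times> nat" where
  "double_node n = (\<lambda>(i, b). if b then (1, n + i) else (0, i))"

lemma mem_double_nodes:
  "(i, j) \<in> double_node n ` ({..<n} \<times> UNIV) \<longleftrightarrow> i = 0 \<and> j < n \<or> i = 1 \<and> n \<le> j \<and> j < 2 * n"
proof
  assume "i = 0 \<and> j < n \<or> i = 1 \<and> n \<le> j \<and> j < 2 * n"
  then have "(i, j) = double_node n (if i = 0 then (j, False) else (j - n, True))"
    and "(if i = 0 then (j, False) else (j - n, True)) \<in> {..<n} \<times> UNIV"
    by (auto simp: double_node_def)
  then show "(i, j) \<in> double_node n ` ({..<n} \<times> UNIV)" by (rule image_eqI)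
qed (auto simp: double_node_def split: if_splits)

text \<open>The rows below \<open>2 n\<close> contain \<open>3 n\<close> zeros on the other columns and one double point; then the
  columns 0 and 1 contain \<open>n\<close> simple and \<open>n\<close> double zeros on these rows and two more zeros.\<close>
lemma biform_coeff_eq_0_if_double_nodes:
  fixes e :: "nat \<times> nat \<Rightarrow> 'a::field_char_0"
  assumes d: "d = 3 * n + 1"
    and high: "\<And>i b. 2 \<le> i \<Longrightarrow> i \<le> d \<Longrightarrow> biform d e (of_nat i, b) = 0"
    and simple: "\<And>i j. i < 2 \<Longrightarrow> j \<in> {2 * n, 2 * n + 1} \<Longrightarrow> biform d e (nat_point (i, j)) = 0"
    and double: "\<And>P. P \<in> nat_point ` double_node n ` ({..<n} \<times> UNIV) \<Longrightarrow>
      biform d e P = 0 \<and> biform_da d e P = 0 \<and> biform_db d e P = 0"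
    and q: "q \<in> {..d} \<times> {..d}"
  shows "e q = 0"
proof -
  have node: "biform d e (of_nat i, of_nat j) = 0" "biform_da d e (of_nat i, of_nat j) = 0"
    "biform_db d e (of_nat i, of_nat j) = 0"
    if "i = 0 \<and> j < n \<or> i = 1 \<and> n \<le> j \<and> j < 2 * n" for i j
    using double[OF imageI, of "(i, j)"] that unfolding mem_double_nodes by simp_all
  have row: "biform d e (a, of_nat j) = 0" if j: "j < 2 * n" for j a
  proof -
    define i where "i = (if j < n then 0 else 1 :: nat)"
    have ij: "i = 0 \<and> j < n \<or> i = 1 \<and> n \<le> j \<and> j < 2 * n" using j by (simp add: i_def)
    show ?thesis
    proof (rule biform_row_eq_0[of "insert i {2..d}" "{i}"])
      have "card (insert i {2..d}) = d" using ij d by (subst card_insert_disjoint) auto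
      then show "d < card (insert i {2..d}) + card {i}" by simp
    qed (use node[OF ij] high in auto)
  qed
  have low: "biform d e (of_nat i, b) = 0" if i: "i < 2" for i b
  proof (rule biform_column_eq_0[of "{..2 * n + 1}" "if i = 0 then {..<n} else {n..<2 * n}"])
    show "biform d e (of_nat i, of_nat j) = 0" if "j \<in> {..2 * n + 1}" for j
    proof (cases "j < 2 * n")
      case False
      then have "j \<in> {2 * n, 2 * n + 1}" using that by auto
      from simple[OF i this] show ?thesis by simp
    qed (rule row)
    show "biform_db d e (of_nat i, of_nat j) = 0"
      if "j \<in> (if i = 0 then {..<n} else {n..<2 * n})" for j
      by (rule node(3)) (use that i in \<open>auto split: if_splits\<close>)
  qed (auto simp: d)
  have "biform d e (of_nat i, b) = 0" if "i \<le> d" for i b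
    using low high that by (cases "i < 2") auto
  then show ?thesis using biform_coeff_eq_0_if_columns_eq_0 q by blast
qed

lemma biform_determining_double_nodes:
  fixes T D :: "('a::field_char_0 \<times> 'a) set"
  assumes columns: "nat_columns {n + 1..3 * n + 1} \<subseteq> T"
    and simple: "nat_point ` ({2..n} \<times> {..3 * n + 1} \<union> {..<2} \<times> {2 * n, 2 * n + 1}) \<subseteq> T"
    and double: "nat_point ` double_node n ` ({..<n} \<times> UNIV) \<subseteq> D" and "D \<subseteq> T"
  shows "biform_determining (3 * n + 1) T D"
proof (rule biform_determiningI)
  let ?d = "3 * n + 1"
  fix e :: "nat \<times> nat \<Rightarrow> 'a" and q
  assume zero: "\<And>P. P \<in> T \<Longrightarrow> biform ?d e P = 0"
    and derivatives: "\<And>P. P \<in> D \<Longrightarrow> biform_da ?d e P = 0" "\<And>P. P \<in> D \<Longrightarrow> biform_db ?d e P = 0"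
    and q: "q \<in> {..?d} \<times> {..?d}"
  have high: "biform ?d e (of_nat i, b) = 0" if i: "2 \<le> i" "i \<le> ?d" for i b
  proof (cases "i \<le> n")
    case True
    have points: "biform ?d e (nat_point (i, j)) = 0" if "j \<le> ?d" for j
      by (rule zero) (use simple i(1) True that in force)
    show ?thesis by (rule biform_column_eq_0[of "{..?d}" "{}"]) (use points in auto)
  next
    case False
    then have "(of_nat i, b) \<in> T" using columns i(2) by auto
    then show ?thesis by (rule zero)
  qed
  have simple_zero: "biform ?d e (nat_point (i, j)) = 0" if "i < 2" "j \<in> {2 * n, 2 * n + 1}" for i j
  proof (rule zero)
    have "(i, j) \<in> {..<2} \<times> {2 * n, 2 * n + 1}" using that by blast
    then show "nat_point (i, j) \<in> T" using simple by blast
  qed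
  show "e q = 0"
    by (rule biform_coeff_eq_0_if_double_nodes[OF refl high simple_zero _ q])
      (use zero derivatives double \<open>D \<subseteq> T\<close> in blast)+
qed

section \<open>Double points of the trace\<close>

definition mon_deriv :: "(nat \<Rightarrow> 'a::comm_semiring_1) \<Rightarrow> (nat \<Rightarrow> 'a) \<Rightarrow> (nat \<Rightarrow> nat) \<Rightarrow> 'a" where
  "mon_deriv x v \<alpha> =
     (\<Sum>m<4. (\<Prod>i\<in>{..<4} - {m}. x i ^ \<alpha> i) * (of_nat (\<alpha> m) * x m ^ (\<alpha> m - 1) * v m))"

definition form_deriv :: "nat \<Rightarrow> ((nat \<Rightarrow> nat) \<Rightarrow> 'a::field) \<Rightarrow> (nat \<Rightarrow> 'a) \<Rightarrow> (nat \<Rightarrow> 'a) \<Rightarrow> 'a" where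
  "form_deriv d c x v = (\<Sum>\<alpha>\<in>mons d. c \<alpha> * mon_deriv x v \<alpha>)"

lemma form_deriv_add_scaled:
  "form_deriv d c x (\<lambda>m. u m + s * v m) = form_deriv d c x u + s * form_deriv d c x v"
  by (simp add: form_deriv_def mon_deriv_def algebra_simps sum.distrib sum_distrib_left)

lemma poly_mon: "poly (mon y \<alpha>) t = mon (\<lambda>m. poly (y m) t) \<alpha>"
  by (simp add: mon_def poly_prod)

lemma poly_pderiv_mon:
  "poly (pderiv (mon y \<alpha>)) t = mon_deriv (\<lambda>m. poly (y m) t) (\<lambda>m. poly (pderiv (y m)) t) \<alpha>"
  unfolding mon_def mon_deriv_def pderiv_prod pderiv_power
  by (simp add: poly_sum poly_prod mult_ac)

lemma form_deriv_eq_0_along_curve: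
  fixes y :: "nat \<Rightarrow> 'a::field_char_0 poly"
  assumes "\<And>t. evalF d c (\<lambda>m. poly (y m) t) = 0"
  shows "form_deriv d c (\<lambda>m. poly (y m) 0) (\<lambda>m. poly (pderiv (y m)) 0) = 0"
proof -
  define p where "p = (\<Sum>\<alpha>\<in>mons d. smult (c \<alpha>) (mon y \<alpha>))"
  have "poly p t = 0" for t
    using assms[of t] by (simp add: p_def poly_sum poly_mon evalF_eq_sum_mon)
  then have "p = 0" using poly_all_0_iff_0 by blast
  then have "poly (pderiv p) 0 = 0" by simp
  then show ?thesis
    by (simp add: p_def pderiv_sum pderiv_smult poly_sum poly_pderiv_mon form_deriv_def)
qed

lemma form_deriv_eq_0_along_chord:
  fixes P Q :: "'a::field_char_0 \<times> 'a"
  assumes "\<And>x. x \<in> chord P Q \<Longrightarrow> evalF d c x = 0"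
  shows "form_deriv d c (seg P) (seg P) = 0" "form_deriv d c (seg P) (seg Q) = 0"
proof -
  have "evalF d c (\<lambda>m. poly [:seg P m, seg P m:] t) = 0" for t
    using assms[OF chordI[of "1 + t" P 0 Q]] by (simp add: distrib_right)
  from form_deriv_eq_0_along_curve[OF this]
  show "form_deriv d c (seg P) (seg P) = 0" by (simp add: pderiv_pCons)
  have "evalF d c (\<lambda>m. poly [:seg P m, seg Q m:] t) = 0" for t
    using assms[OF chordI[of 1 P t Q]] by simp
  from form_deriv_eq_0_along_curve[OF this]
  show "form_deriv d c (seg P) (seg Q) = 0" by (simp add: pderiv_pCons)
qed

definition ruling_tangent_a :: "'a::comm_semiring_1 \<times> 'a \<Rightarrow> nat \<Rightarrow> 'a" where
  "ruling_tangent_a P m = (if m < 2 then 0 else if m = 2 then 1 else snd P)"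

definition ruling_tangent_b :: "'a::comm_semiring_1 \<times> 'a \<Rightarrow> nat \<Rightarrow> 'a" where
  "ruling_tangent_b P m = (if m = 1 then 1 else if m < 3 then 0 else fst P)"

lemma mon_deriv_ruling_tangents:
  fixes P :: "'a::field \<times> 'a"
  shows "mon_deriv (seg P) (ruling_tangent_a P) \<alpha> = bimon_da P (bidegree \<alpha>)"
    and "mon_deriv (seg P) (ruling_tangent_b P) \<alpha> = bimon_db P (bidegree \<alpha>)"
proof -
  obtain a b where P_eq: "P = (a, b)" by (cases P)
  let ?y = "seg ([:a, 1:], [:b:])"
  have "(\<lambda>m. poly (?y m) 0) = seg P" "(\<lambda>m. poly (pderiv (?y m)) 0) = ruling_tangent_a P"
    by (auto simp: P_eq seg_def ruling_tangent_a_def pderiv_pCons pderiv_mult)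
  then have "mon_deriv (seg P) (ruling_tangent_a P) \<alpha> = poly (pderiv (mon ?y \<alpha>)) 0"
    by (simp add: poly_pderiv_mon)
  then show "mon_deriv (seg P) (ruling_tangent_a P) \<alpha> = bimon_da P (bidegree \<alpha>)"
    by (simp add: P_eq mon_seg bimon_def bimon_da_def pderiv_mult pderiv_power pderiv_pCons)
  let ?y = "seg ([:a:], [:b, 1:])"
  have "(\<lambda>m. poly (?y m) 0) = seg P" "(\<lambda>m. poly (pderiv (?y m)) 0) = ruling_tangent_b P"
    by (auto simp: P_eq seg_def ruling_tangent_b_def pderiv_pCons pderiv_mult)
  then have "mon_deriv (seg P) (ruling_tangent_b P) \<alpha> = poly (pderiv (mon ?y \<alpha>)) 0"
    by (simp add: poly_pderiv_mon)
  then show "mon_deriv (seg P) (ruling_tangent_b P) \<alpha> = bimon_db P (bidegree \<alpha>)"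
    by (simp add: P_eq mon_seg bimon_def bimon_db_def bimon_da_def pderiv_mult pderiv_power
        pderiv_pCons mult_ac)
qed

text \<open>The two chords and the tangent of the first ruling span the tangent space at \<open>P\<close>, so the
  derivative along the second ruling vanishes as well.\<close>
lemma double_point_of_trace:
  fixes P P\<^sub>1 P\<^sub>2 :: "'a::field_char_0 \<times> 'a"
  assumes chords: "\<And>x. x \<in> chord P P\<^sub>1 \<union> chord P P\<^sub>2 \<Longrightarrow> evalF d c x = 0"
    and neq: "snd P\<^sub>1 \<noteq> snd P" "snd P\<^sub>2 \<noteq> snd P" "fst P\<^sub>1 \<noteq> fst P\<^sub>2"
    and da: "(\<Sum>\<alpha>\<in>mons d. c \<alpha> * bimon_da P (bidegree \<alpha>)) = 0"
  shows "(\<Sum>\<alpha>\<in>mons d. c \<alpha> * bimon_db P (bidegree \<alpha>)) = 0"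
proof -
  define D where "D = form_deriv d c (seg P)"
  define normal :: "nat \<Rightarrow> 'a" where "normal m = of_bool (3 \<le> m)" for m
  have D_a: "D (ruling_tangent_a P) = 0"
    using da by (simp add: D_def form_deriv_def mon_deriv_ruling_tangents)
  have chord_condition: "D (ruling_tangent_b P) + (fst Q - fst P) * D normal = 0"
    if vanishes: "\<And>x. x \<in> chord P Q \<Longrightarrow> evalF d c x = 0" and "snd Q \<noteq> snd P" for Q
  proof -
    let ?a = "fst Q - fst P" and ?b = "snd Q - snd P"
    have "seg Q = (\<lambda>m. ((seg P m + ?a * ruling_tangent_a P m) + ?b * ruling_tangent_b P m)
        + (?a * ?b) * normal m)"
      by (rule ext)
        (auto simp: seg_def ruling_tangent_a_def ruling_tangent_b_def normal_def algebra_simps)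
    then have "D (seg Q) = D (seg P) + ?a * D (ruling_tangent_a P) + ?b * D (ruling_tangent_b P)
        + (?a * ?b) * D normal"
      unfolding D_def by (simp only: form_deriv_add_scaled)
    then have "?b * (D (ruling_tangent_b P) + ?a * D normal) = 0"
      using form_deriv_eq_0_along_chord[OF vanishes] D_a by (simp add: D_def algebra_simps)
    then show ?thesis using \<open>snd Q \<noteq> snd P\<close> by simp
  qed
  have condition: "D (ruling_tangent_b P) + (fst P\<^sub>1 - fst P) * D normal = 0"
    "D (ruling_tangent_b P) + (fst P\<^sub>2 - fst P) * D normal = 0"
    using chord_condition chords neq(1,2) by auto
  have "(fst P\<^sub>1 - fst P\<^sub>2) * D normal = (D (ruling_tangent_b P) + (fst P\<^sub>1 - fst P) * D normal)
      - (D (ruling_tangent_b P) + (fst P\<^sub>2 - fst P) * D normal)"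
    by (simp add: algebra_simps)
  then have "D normal = 0" using neq(3) unfolding condition by simp
  then have "D (ruling_tangent_b P) = 0" using condition(1) by simp
  then show ?thesis by (simp add: D_def form_deriv_def mon_deriv_ruling_tangents)
qed

lemma castelnuovo_double_points:
  fixes L :: "'a::field_char_0 secant set"
  assumes trace: "biform_determining (d + 2) T D"
    and residual: "form_determining d (chords L)"
    and transversal: "\<And>P Q. (P, Q) \<in> L \<Longrightarrow> transversal P Q"
    and nodes: "\<And>P. P \<in> D \<Longrightarrow> \<exists>P\<^sub>1 P\<^sub>2. (P, P\<^sub>1) \<in> L \<union> L\<inverse> \<and> (P, P\<^sub>2) \<in> L \<union> L\<inverse> \<and> fst P\<^sub>1 \<noteq> fst P\<^sub>2"
  shows "trivial_kernel (mons (d + 2))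
    (mon ` (chords L \<union> seg ` T) \<union> (\<lambda>P. bimon_da P \<circ> bidegree) ` D)" (is "trivial_kernel _ ?R")
proof (rule trivial_kernel_if_kernel_subset[OF castelnuovo[OF _ residual transversal]])
  let ?J = "mons (d + 2)"
  show "trivial_kernel ({..d + 2} \<times> {..d + 2}) (bimon ` T \<union> (bimon_da ` D \<union> bimon_db ` D))"
    using trace by (simp add: biform_determining_def)
  show "kernel ?J ?R \<subseteq> kernel ?J
      (mon ` chords L \<union> (\<lambda>r. r \<circ> bidegree) ` (bimon ` T \<union> (bimon_da ` D \<union> bimon_db ` D)))"
  proof
    fix c assume in_kernel: "c \<in> kernel ?J ?R"
    then have vanish: "evalF (d + 2) c x = 0" if "x \<in> chords L \<union> seg ` T" for x
      using that by (auto simp: kernel_def evalF_eq_sum_mon)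
    have simple: "(\<Sum>\<alpha>\<in>?J. c \<alpha> * bimon P (bidegree \<alpha>)) = 0" if "P \<in> T" for P
      using vanish[of "seg P"] that by (simp add: evalF_eq_sum_mon mon_seg)
    have da: "(\<Sum>\<alpha>\<in>?J. c \<alpha> * bimon_da P (bidegree \<alpha>)) = 0" if "P \<in> D" for P
      using in_kernel that by (simp add: kernel_def ball_Un)
    have db: "(\<Sum>\<alpha>\<in>?J. c \<alpha> * bimon_db P (bidegree \<alpha>)) = 0" if "P \<in> D" for P
    proof -
      obtain P\<^sub>1 P\<^sub>2 where ends: "(P, P\<^sub>1) \<in> L \<union> L\<inverse>" "(P, P\<^sub>2) \<in> L \<union> L\<inverse>" "fst P\<^sub>1 \<noteq> fst P\<^sub>2"
        using nodes[OF \<open>P \<in> D\<close>] by blast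
      have "snd Q \<noteq> snd P" if "(P, Q) \<in> L \<union> L\<inverse>" for Q
        using that transversal[of P Q] transversal[of Q P] by (auto simp: transversal_def)
      with ends have "snd P\<^sub>1 \<noteq> snd P" "snd P\<^sub>2 \<noteq> snd P" by blast+
      then show ?thesis
        using vanish chord_subset_chords_symcl[OF ends(1)] chord_subset_chords_symcl[OF ends(2)]
        by (intro double_point_of_trace[OF _ _ _ ends(3) da[OF \<open>P \<in> D\<close>]]) auto
    qed
    show "c \<in> kernel ?J
        (mon ` chords L \<union> (\<lambda>r. r \<circ> bidegree) ` (bimon ` T \<union> (bimon_da ` D \<union> bimon_db ` D)))"
      using vanish simple da db by (simp add: kernel_def ball_Un evalF_eq_sum_mon)
  qed
qed

corollary castelnuovo_simple_points:
  fixes L :: "'a::field_char_0 secant set"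
  assumes "biform_determining (d + 2) T {}" "form_determining d (chords L)"
    and "\<And>P Q. (P, Q) \<in> L \<Longrightarrow> transversal P Q"
  shows "form_determining (d + 2) (chords L \<union> seg ` T)"
  using castelnuovo_double_points[OF assms] by (simp add: form_determining_def)

definition slide :: "'a::plus \<Rightarrow> 'a \<times> 'a \<Rightarrow> 'a \<times> 'a" where
  "slide t P = (fst P + t, snd P)"

definition slide_quotient :: "'a::comm_ring_1 \<times> 'a \<Rightarrow> 'a \<Rightarrow> (nat \<Rightarrow> nat) \<Rightarrow> 'a" where
  "slide_quotient P t \<alpha> = (case bidegree \<alpha> of (i, j) \<Rightarrow>
    (\<Sum>q<i. fst P ^ (i - Suc q) * (fst P + t) ^ q) * snd P ^ j)"

lemma slide_quotient_eq_diff: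
  "t * slide_quotient P t \<alpha> = mon (seg (slide t P)) \<alpha> - mon (seg P) \<alpha>"
  using power_diff_sumr2[of "fst P + t" "fst (bidegree \<alpha>)" "fst P"]
  by (simp add: slide_quotient_def split_def slide_def mon_seg bimon_def
      flip: mult.assoc left_diff_distrib)

lemma slide_quotient_0: "slide_quotient P 0 = bimon_da P \<circ> bidegree"
  by (rule ext) (simp add: slide_quotient_def split_def bimon_da_def flip: power_add)

lemma kernel_slide_quotients:
  fixes X :: "(nat \<Rightarrow> 'a::field) set"
  assumes nodes: "seg ` fst ` N \<subseteq> X" and "t \<noteq> 0"
  shows "kernel (mons d) (mon ` (X \<union> chords (map_prod (slide t) id ` N))) \<subseteq>
    kernel (mons d) ((\<lambda>P. slide_quotient P t) ` fst ` N)"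
proof
  let ?X = "X \<union> chords (map_prod (slide t) id ` N)"
  fix c assume in_kernel: "c \<in> kernel (mons d) (mon ` ?X)"
  have "(\<Sum>\<alpha>\<in>mons d. c \<alpha> * slide_quotient P t \<alpha>) = 0" if PQ: "(P, Q) \<in> N" for P Q
  proof -
    have "seg P \<in> ?X" using nodes PQ by force
    moreover have "(slide t P, Q) \<in> map_prod (slide t) id ` N" using PQ by force
    from subsetD[OF chord_subset_chords[OF this] chord_ends(1)] have "seg (slide t P) \<in> ?X"
      by (rule UnI2)
    ultimately have "(\<Sum>\<alpha>\<in>mons d. c \<alpha> * mon (seg (slide t P)) \<alpha>) = 0"
      "(\<Sum>\<alpha>\<in>mons d. c \<alpha> * mon (seg P) \<alpha>) = 0"
      using in_kernel unfolding kernel_def by blast+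
    moreover have "t * (\<Sum>\<alpha>\<in>mons d. c \<alpha> * slide_quotient P t \<alpha>) =
        (\<Sum>\<alpha>\<in>mons d. c \<alpha> * mon (seg (slide t P)) \<alpha>) - (\<Sum>\<alpha>\<in>mons d. c \<alpha> * mon (seg P) \<alpha>)"
      by (simp add: sum_distrib_left mult.left_commute[of t] slide_quotient_eq_diff
          right_diff_distrib sum_subtractf)
    ultimately show ?thesis using \<open>t \<noteq> 0\<close> by simp
  qed
  then show "c \<in> kernel (mons d) ((\<lambda>P. slide_quotient P t) ` fst ` N)"
    by (auto simp: kernel_def)
qed

text \<open>Detach the chords in \<open>N\<close> from \<open>X\<close> by moving their ends \<open>P\<close> along a ruling by \<open>t\<close>. For
  \<open>t \<noteq> 0\<close> the difference quotient of the values at the two positions of \<open>P\<close> is a condition which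
  follows from the others; it is polynomial in \<open>t\<close>, and at \<open>t = 0\<close> it is the derivative at \<open>P\<close>.\<close>
lemma detach_chords:
  fixes X :: "(nat \<Rightarrow> 'a::field_char_0) set"
  assumes nodes: "seg ` fst ` N \<subseteq> X"
    and limit: "trivial_kernel (mons d)
      (mon ` (X \<union> chords N) \<union> (\<lambda>P. bimon_da P \<circ> bidegree) ` fst ` N)"
  shows "\<exists>t. form_determining d (X \<union> chords (map_prod (slide t) id ` N))"
proof -
  define moving where "moving = (\<lambda>(PQ, s, t) (z :: unit \<Rightarrow> 'a).
    mon (\<lambda>m. s * seg (slide (z ()) (fst PQ)) m + t * seg (snd PQ) m))"
  define R where "R = (\<lambda>x z. mon x) ` X \<union> moving ` (N \<times> UNIV) \<union>
    (\<lambda>P z. slide_quotient P (z ())) ` fst ` N"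
  have R_at: "(\<lambda>r. r z) ` R = mon ` (X \<union> chords (map_prod (slide (z ())) id ` N)) \<union>
      (\<lambda>P. slide_quotient P (z ())) ` fst ` N" for z
    by (simp add: R_def moving_def chords_image image_Un image_image split_def)
  have "map_prod (slide 0) id = (id :: 'a secant \<Rightarrow> _)"
    by (auto simp: slide_def)
  then have "trivial_kernel (mons d) ((\<lambda>r. r (\<lambda>_. 0)) ` R)"
    unfolding R_at using limit by (simp add: slide_quotient_0)
  moreover have "poly_fun (\<lambda>z. r z \<alpha>)" if "r \<in> R" for r \<alpha>
    using that
    by (auto simp: R_def moving_def slide_def slide_quotient_def split_def
        intro!: poly_fun_mon poly_fun_intros poly_fun_seg)
  ultimately have "generic (\<lambda>z. trivial_kernel (mons d) ((\<lambda>r. r z) ` R))"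
    by (intro generic_trivial_kernel finite_mons) auto
  moreover have "generic (\<lambda>z :: unit \<Rightarrow> 'a. z () \<noteq> 0)"
    by (rule genericI[OF pf_var, of "\<lambda>_. 1"]) simp_all
  ultimately obtain z where trivial: "trivial_kernel (mons d) ((\<lambda>r. r z) ` R)" and "z () \<noteq> 0"
    using generic_witness[OF generic_conj] by blast
  have "form_determining d (X \<union> chords (map_prod (slide (z ())) id ` N))"
    unfolding form_determining_def
  proof (rule trivial_kernel_if_kernel_subset[OF trivial])
    show "kernel (mons d) (mon ` (X \<union> chords (map_prod (slide (z ())) id ` N))) \<subseteq>
        kernel (mons d) ((\<lambda>r. r z) ` R)"
      using kernel_slide_quotients[OF nodes \<open>z () \<noteq> 0\<close>] unfolding R_at kernel_Un by blast
  qed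
  then show ?thesis by blast
qed

section \<open>Configurations of chords\<close>

definition vertex :: "('v \<times> bool \<Rightarrow> 'a) \<Rightarrow> 'v \<Rightarrow> 'a \<times> 'a" where
  "vertex w v = (w (v, False), w (v, True))"

definition coords :: "('v \<Rightarrow> 'a \<times> 'a) \<Rightarrow> 'v \<times> bool \<Rightarrow> 'a" where
  "coords f = (\<lambda>(v, c). if c then snd (f v) else fst (f v))"

lemma vertex_coords [simp]: "vertex (coords f) = f"
  by (simp add: fun_eq_iff vertex_def coords_def)

definition edges :: "('v \<times> bool \<Rightarrow> 'a) \<Rightarrow> ('v \<times> 'v) set \<Rightarrow> 'a secant set" where
  "edges w E = map_prod (vertex w) (vertex w) ` E"

lemma Field_map_prod: "Field (map_prod f f ` E) = f ` Field E"
  by (force simp: Field_def)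

lemma card_edges_le: "finite E \<Longrightarrow> card (edges w E) \<le> card E"
  unfolding edges_def by (rule card_image_le)

lemma seg_vertices_subset_chords: "seg ` vertex w ` Field E \<subseteq> chords (edges w E)"
proof -
  have "seg (vertex w v) \<in> chords (edges w E)" if v: "v \<in> Field E" for v
  proof -
    obtain u where "(v, u) \<in> E \<or> (u, v) \<in> E" using v by (auto simp: Field_def)
    then have "(vertex w v, vertex w u) \<in> edges w E \<or> (vertex w u, vertex w v) \<in> edges w E"
      by (force simp: edges_def)
    then show ?thesis using chord_subset_chords chord_ends by blast
  qed
  then show ?thesis by blast
qed

lemma generic_form_determining_edges:
  fixes w\<^sub>0 :: "'v \<times> bool \<Rightarrow> 'a::field_char_0"
  assumes "form_determining d (chords (edges w\<^sub>0 E))"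
  shows "generic (\<lambda>w :: 'v \<times> bool \<Rightarrow> 'a. form_determining d (chords (edges w E)))"
proof -
  define R where "R = (\<lambda>((u, v), s, t) (w :: 'v \<times> bool \<Rightarrow> 'a).
    mon (\<lambda>m. s * seg (vertex w u) m + t * seg (vertex w v) m)) ` (E \<times> UNIV)"
  have R_at: "(\<lambda>r. r w) ` R = mon ` chords (edges w E)" for w
    by (simp add: R_def edges_def chords_image image_image split_def)
  have "poly_fun (\<lambda>w. r w \<alpha>)" if "r \<in> R" for r \<alpha>
    using that by (auto simp: R_def vertex_def intro!: poly_fun_mon poly_fun_intros poly_fun_seg)
  then show ?thesis
    using assms generic_trivial_kernel[of "mons d" R w\<^sub>0]
    by (simp add: form_determining_def finite_mons R_at)
qed

lemma generic_biform_determining_vertices: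
  fixes w\<^sub>0 :: "'v \<times> bool \<Rightarrow> 'a::field_char_0"
  assumes "biform_determining d
    (vertex w\<^sub>0 ` S \<union> (fst \<circ> vertex w\<^sub>0) ` V \<times> UNIV \<union> K) (vertex w\<^sub>0 ` N)"
  shows "generic (\<lambda>w :: 'v \<times> bool \<Rightarrow> 'a.
    biform_determining d (vertex w ` S \<union> (fst \<circ> vertex w) ` V \<times> UNIV \<union> K) (vertex w ` N))"
proof -
  define R :: "(('v \<times> bool \<Rightarrow> 'a) \<Rightarrow> nat \<times> nat \<Rightarrow> 'a) set" where
    "R = (\<lambda>v w. bimon (vertex w v)) ` S \<union> (\<lambda>(v, b) w. bimon (w (v, False), b)) ` (V \<times> UNIV)
      \<union> (\<lambda>P w. bimon P) ` K
      \<union> ((\<lambda>v w. bimon_da (vertex w v)) ` N \<union> (\<lambda>v w. bimon_db (vertex w v)) ` N)"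
  have columns: "(fst \<circ> vertex w) ` V \<times> UNIV = (\<lambda>(v, b). (w (v, False), b)) ` (V \<times> UNIV)"
    for w :: "'v \<times> bool \<Rightarrow> 'a" by (auto simp: vertex_def)
  have R_at: "(\<lambda>r. r w) ` R = bimon ` (vertex w ` S \<union> (fst \<circ> vertex w) ` V \<times> UNIV \<union> K)
      \<union> (bimon_da ` vertex w ` N \<union> bimon_db ` vertex w ` N)" for w
    unfolding columns by (simp add: R_def image_Un image_image split_def)
  have "poly_fun (\<lambda>w. r w q)" if "r \<in> R" for r q
    using that unfolding R_def
    by (auto simp: vertex_def bimon_def bimon_da_def bimon_db_def intro!: poly_fun_intros)
  then show ?thesis
    using assms generic_trivial_kernel[of "{..d} \<times> {..d}" R w\<^sub>0]
    by (simp add: biform_determining_def R_at)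
qed

lemma generic_transversal_edges:
  assumes "finite E" "irrefl E"
  shows "generic (\<lambda>w :: 'v \<times> bool \<Rightarrow> 'a::field_char_0.
    \<forall>(u, v)\<in>E. transversal (vertex w u) (vertex w v))"
proof -
  have "generic (\<lambda>w :: 'v \<times> bool \<Rightarrow> 'a. \<forall>e\<in>E.
      w (fst e, False) \<noteq> w (snd e, False) \<and> w (fst e, True) \<noteq> w (snd e, True))"
    by (intro generic_ball generic_conj generic_neq) (use assms in \<open>auto simp: irrefl_def\<close>)
  then show ?thesis by (simp add: transversal_def vertex_def split_def)
qed

lemma finite_card_le_covered:
  assumes "finite T" "finite S" "card T \<le> card S"
  obtains f where "T \<subseteq> f ` S"
proof -
  obtain h where "inj_on h T" "h ` T \<subseteq> S"
    using inj_on_iff_card_le[OF assms(1,2)] assms(3) by blast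
  then have "T \<subseteq> inv_into T h ` S" by (metis image_mono inv_into_image_cancel subset_refl)
  then show thesis by (rule that)
qed

definition determining_lines ::
  "nat \<Rightarrow> nat \<Rightarrow> 'a::field secant set \<Rightarrow> bool" where
  "determining_lines d n L \<longleftrightarrow> finite L \<and> card L \<le> n \<and> form_determining d (chords L)"

definition matching :: "nat \<Rightarrow> ((nat \<times> bool) \<times> (nat \<times> bool)) set" where
  "matching n = (\<lambda>i. ((i, False), (i, True))) ` {..<n}"

lemma finite_matching: "finite (matching n)"
  by (simp add: matching_def)

lemma card_matching: "card (matching n) = n"
  by (simp add: matching_def card_image inj_on_def)

lemma irrefl_matching: "irrefl (matching n)"
  by (auto simp: matching_def irrefl_def)

lemma Field_matching: "Field (matching n) = {..<n} \<times> UNIV"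
proof -
  have "UNIV = {False, True}" by auto
  then show ?thesis by (auto simp: matching_def Field_def Domain_fst Range_snd image_image)
qed

lemma determining_lines_matching:
  fixes L :: "'a::field secant set"
  assumes "determining_lines d n L"
  shows "\<exists>w :: (nat \<times> bool) \<times> bool \<Rightarrow> 'a. form_determining d (chords (edges w (matching n)))"
proof -
  have "finite L" "card L \<le> card {..<n}" and determining: "form_determining d (chords L)"
    using assms by (simp_all add: determining_lines_def)
  then obtain f where "L \<subseteq> f ` {..<n}"
    using finite_card_le_covered[OF _ finite_lessThan] by blast
  define w where "w = coords (\<lambda>(i, b). if b then snd (f i) else fst (f i))"
  have "L \<subseteq> edges w (matching n)"
    using \<open>L \<subseteq> f ` {..<n}\<close> by (simp add: w_def edges_def matching_def image_image)
  then show ?thesis using form_determining_mono[OF determining chords_mono] by blast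
qed

definition rulings :: "nat set \<Rightarrow> 'a::field secant set" where
  "rulings I = (\<lambda>i. ((of_nat i, 0), (of_nat i, 1))) ` I"

lemma card_rulings_le: "finite I \<Longrightarrow> card (rulings I :: 'a::field secant set) \<le> card I"
  unfolding rulings_def by (rule card_image_le)

lemma seg_nat_columns_subset_rulings: "seg ` nat_columns I \<subseteq> chords (rulings I)"
proof -
  have "seg (of_nat i, b) \<in> chords (rulings I)" if "i \<in> I" for i and b :: 'a
    using seg_mem_ruling[of 0 1 "of_nat i" b] that by (auto simp: chords_def rulings_def)
  then show ?thesis by auto
qed

lemma inj_on_bidegree_mons:
  assumes "d \<le> 1"
  shows "inj_on bidegree (mons d)"
proof (rule inj_onI)
  fix \<alpha> \<beta> assume mons: "\<alpha> \<in> mons d" "\<beta> \<in> mons d" and "bidegree \<alpha> = bidegree \<beta>"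
  with assms have "\<alpha> 0 = \<beta> 0" "\<alpha> 1 = \<beta> 1" "\<alpha> 2 = \<beta> 2" "\<alpha> 3 = \<beta> 3"
    unfolding mons_iff bidegree_def prod.inject by linarith+
  then have "\<forall>i<4. \<alpha> i = \<beta> i" by (simp add: numeral_eq_Suc All_less_Suc)
  then show "\<alpha> = \<beta>" by (intro mons_eqI[OF mons]) blast
qed

lemma determining_lines_rulings:
  assumes "d \<le> 1"
  shows "determining_lines d (d + 1) (rulings {..d} :: 'a::field_char_0 secant set)"
proof -
  have "form_determining d (chords (rulings {..d}) :: (nat \<Rightarrow> 'a) set)"
  proof (rule form_determiningI)
    fix c :: "(nat \<Rightarrow> nat) \<Rightarrow> 'a" and \<alpha>
    assume zero: "\<And>x. x \<in> chords (rulings {..d}) \<Longrightarrow> evalF d c x = 0" and \<alpha>: "\<alpha> \<in> mons d"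
    have columns: "biform d (quadric_trace d c) P = 0" if "P \<in> nat_columns {..d}" for P
    proof -
      from zero[OF subsetD[OF seg_nat_columns_subset_rulings imageI[OF that]]] show ?thesis
        by (simp add: biform_def sum_quadric_trace evalF_eq_sum_mon mon_seg)
    qed
    have "quadric_trace d c (bidegree \<alpha>) = 0"
      by (rule biform_coeff_eq_0_if_columns_eq_0[OF _ bidegree_mons[OF \<alpha>]]) (use columns in auto)
    moreover have "{\<beta> \<in> mons d. bidegree \<beta> = bidegree \<alpha>} = {\<alpha>}"
      using inj_on_bidegree_mons[OF assms] \<alpha> by (auto simp: inj_on_def)
    ultimately show "c \<alpha> = 0" by (simp add: quadric_trace_def)
  qed
  then show ?thesis
    using card_rulings_le[of "{..d}"] by (simp add: determining_lines_def rulings_def)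
qed

section \<open>Castelnuovo steps\<close>

text \<open>The vertices in \<open>V\<close> prescribe lines of the first ruling, those in \<open>S\<close> only points.\<close>
lemma biform_determining_vertices_exist:
  fixes K :: "(nat \<times> nat) set"
  assumes "finite V" "finite S" "V \<inter> S = {}"
    and columns: "card {u..<m} \<le> card V" and grid: "card ({..<u} \<times> {..d} - K) \<le> card S"
  shows "\<exists>w :: 'v \<times> bool \<Rightarrow> 'a::field_char_0. biform_determining d
    (vertex w ` S \<union> (fst \<circ> vertex w) ` V \<times> UNIV \<union> (nat_columns {m..d} \<union> nat_point ` K)) {}"
proof -
  obtain f where grid_covered: "{..<u} \<times> {..d} - K \<subseteq> f ` S"
    using finite_card_le_covered[OF _ assms(2) grid] by blast
  obtain g where columns_covered: "{u..<m} \<subseteq> g ` V"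
    using finite_card_le_covered[OF _ assms(1) columns] by blast
  define w :: "'v \<times> bool \<Rightarrow> 'a" where "w = coords (\<lambda>v. nat_point (if v \<in> V then (g v, 0) else f v))"
  have S_points: "vertex w ` S = nat_point ` f ` S"
    unfolding w_def image_image by (rule image_cong) (use assms(3) in auto)
  have V_columns: "(fst \<circ> vertex w) ` V = of_nat ` g ` V"
    unfolding w_def image_image by (rule image_cong) auto
  have "biform_determining d
    (nat_point ` f ` S \<union> of_nat ` g ` V \<times> UNIV \<union> (nat_columns {m..d} \<union> nat_point ` K)
      :: ('a \<times> 'a) set) {}"
  proof (rule biform_determining_grid[where u = u])
    have "{u..d} \<subseteq> g ` V \<union> {m..d}" using columns_covered by force
    from image_mono[OF this, of of_nat]
    show "nat_columns {u..d} \<subseteq> nat_point ` f ` S \<union> of_nat ` g ` V \<times> UNIV \<union>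
        (nat_columns {m..d} \<union> nat_point ` K)" by (auto simp: image_Un)
    have "{..<u} \<times> {..d} \<subseteq> f ` S \<union> K" using grid_covered by blast
    then have "nat_point ` ({..<u} \<times> {..d}) \<subseteq> nat_point ` f ` S \<union> nat_point ` K"
      unfolding image_Un[symmetric] by (rule image_mono)
    also have "\<dots> \<subseteq> (nat_point ` f ` S \<union> of_nat ` g ` V \<times> UNIV) \<union>
        (nat_columns {m..d} \<union> nat_point ` K)"
      by (intro Un_mono Un_upper1 Un_upper2)
    finally show "nat_point ` ({..<u} \<times> {..d}) \<subseteq> nat_point ` f ` S \<union> of_nat ` g ` V \<times> UNIV \<union>
        (nat_columns {m..d} \<union> nat_point ` K)" .
  qed
  then show ?thesis unfolding S_points[symmetric] V_columns[symmetric] by blast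
qed

lemma determining_matching_with_ruling_lines:
  fixes L :: "'a::field_char_0 secant set" and K :: "(nat \<times> nat) set"
  assumes lines: "determining_lines d n L" and partition: "V \<union> S = {..<n} \<times> UNIV" "V \<inter> S = {}"
    and columns: "card {u..<m} \<le> card V" and grid: "card ({..<u} \<times> {..d + 2} - K) \<le> card S"
  shows "\<exists>w :: (nat \<times> bool) \<times> bool \<Rightarrow> 'a. form_determining (d + 2) (chords (edges w (matching n)) \<union>
    seg ` ((fst \<circ> vertex w) ` V \<times> UNIV \<union> (nat_columns {m..d + 2} \<union> nat_point ` K)))"
proof -
  let ?trace = "\<lambda>w :: (nat \<times> bool) \<times> bool \<Rightarrow> 'a. vertex w ` S \<union> (fst \<circ> vertex w) ` V \<times> UNIV \<union>
    (nat_columns {m..d + 2} \<union> nat_point ` K)"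
  have "finite (V \<union> S)" unfolding partition(1) by simp
  then obtain w\<^sub>1 where "biform_determining (d + 2) (?trace w\<^sub>1) {}"
    using biform_determining_vertices_exist[OF _ _ partition(2) columns grid] by auto
  then have trace: "generic (\<lambda>w. biform_determining (d + 2) (?trace w) {})"
    using generic_biform_determining_vertices[where N = "{}"] by simp
  obtain w\<^sub>0 :: "_ \<Rightarrow> 'a" where "form_determining d (chords (edges w\<^sub>0 (matching n)))"
    using determining_lines_matching[OF lines] by blast
  then have residual: "generic (\<lambda>w :: _ \<Rightarrow> 'a. form_determining d (chords (edges w (matching n))))"
    by (rule generic_form_determining_edges)
  obtain w :: "(nat \<times> bool) \<times> bool \<Rightarrow> 'a"
    where "form_determining d (chords (edges w (matching n)))"
      and "biform_determining (d + 2) (?trace w) {}"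
      and "\<forall>(u, v)\<in>matching n. transversal (vertex w u) (vertex w v)"
    using generic_witness[OF generic_conj[OF residual generic_conj[OF trace
          generic_transversal_edges[OF finite_matching irrefl_matching]]]] by blast
  then have "form_determining (d + 2) (chords (edges w (matching n)) \<union> seg ` ?trace w)"
    by (intro castelnuovo_simple_points) (auto simp: edges_def)
  moreover have "vertex w ` S \<subseteq> vertex w ` Field (matching n)"
    unfolding Field_matching using partition(1) by blast
  then have "seg ` vertex w ` S \<subseteq> chords (edges w (matching n))"
    using seg_vertices_subset_chords by (meson image_mono order_trans)
  ultimately show ?thesis
    by (intro exI[of _ w]) (simp add: image_Un Un_assoc[symmetric] Un_absorb2)
qed

lemma add_ruling_lines_and_points:
  fixes L :: "'a::field_char_0 secant set" and K :: "(nat \<times> nat) set"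
  assumes lines: "determining_lines d n L" and r: "r + u = d + 3"
    and grid: "card ({..<u} \<times> {..d + 2} - K) \<le> 2 * n"
  shows "\<exists>L' :: 'a secant set. finite L' \<and> card L' \<le> n + r \<and>
    form_determining (d + 2) (chords L' \<union> seg ` nat_point ` K)"
proof -
  have "card ({..<u} \<times> {..d + 2} - K) \<le> card ({..<n} \<times> (UNIV :: bool set))"
    using grid by (simp add: card_cartesian_product mult.commute)
  from determining_matching_with_ruling_lines[OF lines _ _ _ this, of "{}" u]
  obtain w :: "(nat \<times> bool) \<times> bool \<Rightarrow> 'a" where determining: "form_determining (d + 2)
      (chords (edges w (matching n)) \<union> seg ` (nat_columns {u..d + 2} \<union> nat_point ` K))" by auto
  define L' where "L' = edges w (matching n) \<union> rulings {u..d + 2}"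
  have "form_determining (d + 2) (chords L' \<union> seg ` nat_point ` K)"
    by (rule form_determining_mono[OF determining], unfold L'_def chords_Un image_Un Un_assoc)
      (intro Un_mono subset_refl seg_nat_columns_subset_rulings)
  moreover have "card L' \<le> card (matching n) + card {u..d + 2}"
    unfolding L'_def
    by (intro order_trans[OF card_Un_le] add_mono card_edges_le card_rulings_le finite_matching)
      simp
  then have "card L' \<le> n + r" using r by (simp add: card_matching)
  ultimately show ?thesis
    by (intro exI[of _ L']) (simp add: L'_def edges_def rulings_def finite_matching)
qed

corollary add_ruling_lines:
  fixes L :: "'a::field_char_0 secant set"
  assumes "determining_lines d n L" "r + u = d + 3" "u * (d + 3) \<le> 2 * n"
  shows "\<exists>L' :: 'a secant set. determining_lines (d + 2) (n + r) L'"
proof -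
  have "card ({..<u} \<times> {..d + 2} - {}) \<le> 2 * n"
    using assms(3) by (simp add: card_cartesian_product numeral_3_eq_3)
  from add_ruling_lines_and_points[OF assms(1,2) this] show ?thesis
    by (simp add: determining_lines_def)
qed

text \<open>For \<open>i < k\<close> the edge \<open>i\<close> of the matching and the pendant edges at its two ends form a chain of
  three lines; \<open>Inr v\<close> is the free end of the pendant edge at \<open>v\<close>.\<close>
definition pendants :: "nat \<Rightarrow> ((nat \<times> bool) + (nat \<times> bool)) rel" where
  "pendants k = (\<lambda>v. (Inl v, Inr v)) ` ({..<k} \<times> UNIV)"

definition chain_graph :: "nat \<Rightarrow> nat \<Rightarrow> ((nat \<times> bool) + (nat \<times> bool)) rel" where
  "chain_graph n k = map_prod Inl Inl ` matching n \<union> pendants k"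

lemma chain_graph_determining:
  fixes L :: "'a::field_char_0 secant set"
  assumes lines: "determining_lines d n L" and "k \<le> n"
    and u: "2 * k + 1 + u = d + 3" and grid: "u * (d + 3) \<le> 2 * (n - k)"
  shows "\<exists>w :: _ \<Rightarrow> 'a. form_determining (d + 2) (chords (edges w (chain_graph (n + 1) k)))"
proof -
  let ?V = "{..<k} \<times> (UNIV :: bool set)" and ?S = "{k..<n} \<times> (UNIV :: bool set)"
  have partition: "?V \<union> ?S = {..<n} \<times> UNIV" "?V \<inter> ?S = {}" using \<open>k \<le> n\<close> by auto
  have columns: "card {u..<d + 2} \<le> card ?V"
    and grid_points: "card ({..<u} \<times> {..d + 2} - {}) \<le> card ?S"
    using u grid by (simp_all add: card_cartesian_product numeral_3_eq_3 mult.commute)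
  obtain w :: "(nat \<times> bool) \<times> bool \<Rightarrow> 'a" where determining: "form_determining (d + 2)
      (chords (edges w (matching n)) \<union> seg ` ((fst \<circ> vertex w) ` ?V \<times> UNIV \<union> nat_columns {d + 2}))"
    using determining_matching_with_ruling_lines[OF lines partition columns grid_points] by auto
  define w' :: "_ \<Rightarrow> 'a" where "w' = coords (case_sum
      (\<lambda>(i, b). if i < n then vertex w (i, b) else (of_nat (d + 2), of_bool b))
      (\<lambda>v. (fst (vertex w v), snd (vertex w v) + 1)))"
  let ?E = "edges w' (chain_graph (n + 1) k)"
  have "edges w (matching n) \<union> rulings {d + 2} = edges w' (map_prod Inl Inl ` matching (n + 1))"
    by (simp add: edges_def matching_def rulings_def lessThan_Suc image_image w'_def insert_commute
        cong: image_cong_simp)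
  then have matching_rulings: "chords (edges w (matching n)) \<union> chords (rulings {d + 2}) \<subseteq> chords ?E"
    unfolding chords_Un[symmetric] by (simp add: chain_graph_def edges_def image_Un chords_mono)
  have pendant_rulings: "seg (fst (vertex w v), b) \<in> chords ?E" if "v \<in> ?V" for v b
  proof -
    let ?P = "(fst (vertex w v), snd (vertex w v))"
      and ?Q = "(fst (vertex w v), snd (vertex w v) + 1)"
    have "(Inl v, Inr v) \<in> chain_graph (n + 1) k"
      using that by (auto simp: chain_graph_def pendants_def)
    from imageI[OF this, of "map_prod (vertex w') (vertex w')"] have "(?P, ?Q) \<in> ?E"
      using that \<open>k \<le> n\<close> by (auto simp: edges_def w'_def)
    moreover have "seg (fst (vertex w v), b) \<in> chord ?P ?Q" by (rule seg_mem_ruling) simp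
    ultimately show ?thesis using chord_subset_chords by blast
  qed
  have "seg ` ((fst \<circ> vertex w) ` ?V \<times> UNIV) \<subseteq> chords ?E" using pendant_rulings by auto
  moreover have "seg ` nat_columns {d + 2} \<subseteq> chords ?E"
    by (rule subset_trans[OF seg_nat_columns_subset_rulings]) (use matching_rulings in simp)
  ultimately have "chords (edges w (matching n)) \<union>
      seg ` ((fst \<circ> vertex w) ` ?V \<times> UNIV \<union> nat_columns {d + 2}) \<subseteq> chords ?E"
    using matching_rulings by (simp only: image_Un Un_subset_iff)
  from form_determining_mono[OF determining this] show ?thesis by blast
qed

lemma finite_pendants: "finite (pendants k)"
  by (simp add: pendants_def)

lemma card_pendants: "card (pendants k) = 2 * k"
  by (simp add: pendants_def card_image inj_on_def card_cartesian_product)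

lemma finite_chain_graph: "finite (chain_graph n k)"
  by (simp add: chain_graph_def finite_matching finite_pendants)

lemma irrefl_chain_graph: "irrefl (chain_graph n k)"
  by (auto simp: chain_graph_def pendants_def matching_def irrefl_def)

lemma Field_chain_graph:
  assumes "k \<le> n"
  shows "Field (chain_graph n k) = Inl ` ({..<n} \<times> UNIV) \<union> Inr ` ({..<k} \<times> UNIV)"
proof -
  have "Field (pendants k) = Inl ` ({..<k} \<times> UNIV) \<union> Inr ` ({..<k} \<times> UNIV)"
    by (force simp: Field_def pendants_def)
  then show ?thesis
    using assms by (auto simp: chain_graph_def Field_map_prod Field_matching)
qed

lemma double_nodes_of_chains_exist:
  assumes "k \<le> n" and "(k - 1) * (3 * k + 2) + 4 \<le> 2 * n"
  shows "\<exists>w :: _ \<Rightarrow> 'a::field_char_0. biform_determining (3 * k + 1)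
    (vertex w ` Field (chain_graph n k) \<union> nat_columns {k + 1..3 * k + 1})
    (vertex w ` Inl ` ({..<k} \<times> UNIV))"
proof -
  let ?T = "{2..k} \<times> {..3 * k + 1} \<union> {..<2} \<times> {2 * k, 2 * k + 1}"
  let ?N = "Inl ` ({..<k} \<times> UNIV) :: ((nat \<times> bool) + (nat \<times> bool)) set"
  let ?S = "Inl ` ({k..<n} \<times> UNIV) \<union> Inr ` ({..<k} \<times> UNIV) :: ((nat \<times> bool) + (nat \<times> bool)) set"
  have Field: "Field (chain_graph n k) = ?N \<union> ?S"
    unfolding Field_chain_graph[OF assms(1)] using assms(1) by (auto simp: image_iff)
  have "card ?T = (k - 1) * (3 * k + 2) + 4"
    by (subst card_Un_disjoint) (auto simp: card_cartesian_product)
  moreover have "card ?S = 2 * (n - k) + 2 * k"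
    by (subst card_Un_disjoint) (auto simp: card_image card_cartesian_product)
  ultimately have card: "card ?T \<le> card ?S" using assms by simp
  obtain f where covered: "?T \<subseteq> f ` ?S"
    by (rule finite_card_le_covered[OF _ _ card]) simp_all
  define w :: "_ \<Rightarrow> 'a" where "w = coords (\<lambda>v. nat_point
    (case v of Inl u \<Rightarrow> if fst u < k then double_node k u else f v | Inr u \<Rightarrow> f v))"
  have simple: "vertex w ` ?S = nat_point ` f ` ?S"
    unfolding image_image by (rule image_cong) (auto simp: w_def)
  have double: "vertex w ` ?N = nat_point ` double_node k ` ({..<k} \<times> UNIV)"
    unfolding image_image by (rule image_cong) (auto simp: w_def)
  have "biform_determining (3 * k + 1)
    (vertex w ` Field (chain_graph n k) \<union> nat_columns {k + 1..3 * k + 1}) (vertex w ` ?N)"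
  proof (rule biform_determining_double_nodes)
    have "nat_point ` ?T \<subseteq> vertex w ` ?S" unfolding simple by (rule image_mono[OF covered])
    also have "\<dots> \<subseteq> vertex w ` Field (chain_graph n k) \<union> nat_columns {k + 1..3 * k + 1}"
      unfolding Field by (intro le_supI1 image_mono Un_upper2)
    finally show "nat_point ` ?T \<subseteq>
      vertex w ` Field (chain_graph n k) \<union> nat_columns {k + 1..3 * k + 1}" .
    show "nat_point ` double_node k ` ({..<k} \<times> UNIV) \<subseteq> vertex w ` ?N"
      by (simp only: double subset_refl)
    show "vertex w ` ?N \<subseteq> vertex w ` Field (chain_graph n k) \<union> nat_columns {k + 1..3 * k + 1}"
      unfolding Field by (intro le_supI1 image_mono Un_upper1)
  qed simp
  then show ?thesis by blast
qed

lemma chain_graph_node_chords: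
  assumes "i < k" "k \<le> n" and neq: "w (Inl (i, \<not> b), False) \<noteq> w (Inr (i, b), False)"
  defines "L \<equiv> edges w (chain_graph n k)" and "P \<equiv> vertex w (Inl (i, b))"
  shows "\<exists>P\<^sub>1 P\<^sub>2. (P, P\<^sub>1) \<in> L \<union> L\<inverse> \<and> (P, P\<^sub>2) \<in> L \<union> L\<inverse> \<and> fst P\<^sub>1 \<noteq> fst P\<^sub>2"
proof -
  have "(Inl (i, False), Inl (i, True)) \<in> chain_graph n k"
    and "(Inl (i, b), Inr (i, b)) \<in> chain_graph n k"
    using assms(1,2) by (auto simp: chain_graph_def matching_def pendants_def image_image)
  from this[THEN imageI, of "map_prod (vertex w) (vertex w)"]
  have "(P, vertex w (Inl (i, \<not> b))) \<in> L \<union> L\<inverse>" "(P, vertex w (Inr (i, b))) \<in> L"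
    unfolding L_def P_def edges_def by (cases b; simp)+
  moreover have "fst (vertex w (Inl (i, \<not> b))) \<noteq> fst (vertex w (Inr (i, b)))"
    using neq by (simp add: vertex_def)
  ultimately show ?thesis by blast
qed

lemma chain_limit_determining:
  fixes w\<^sub>0 :: "_ \<Rightarrow> 'a::field_char_0"
  assumes chain: "form_determining d (chords (edges w\<^sub>0 (chain_graph n k)))"
    and d: "d + 2 = 3 * k + 1" and "k \<le> n" and "(k - 1) * (3 * k + 2) + 4 \<le> 2 * n"
  shows "\<exists>w :: _ \<Rightarrow> 'a. trivial_kernel (mons (d + 2))
    (mon ` chords (edges w (chain_graph n k) \<union> rulings {k + 1..3 * k + 1}) \<union>
      (\<lambda>P. bimon_da P \<circ> bidegree) ` vertex w ` Inl ` ({..<k} \<times> UNIV))"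
proof -
  let ?E = "chain_graph n k" and ?N = "Inl ` ({..<k} \<times> UNIV)"
  let ?T = "\<lambda>w :: _ \<Rightarrow> 'a. vertex w ` Field ?E \<union> nat_columns {k + 1..3 * k + 1}"
  obtain w\<^sub>1 where "biform_determining (d + 2) (?T w\<^sub>1) (vertex w\<^sub>1 ` ?N)"
    using double_nodes_of_chains_exist[OF assms(3,4)] unfolding d by blast
  then have trace: "generic (\<lambda>w. biform_determining (d + 2) (?T w) (vertex w ` ?N))"
    using generic_biform_determining_vertices[where V = "{}" and w\<^sub>0 = w\<^sub>1] by simp
  have ends: "generic (\<lambda>w :: _ \<Rightarrow> 'a.
      \<forall>v\<in>{..<k} \<times> UNIV. w (Inl (fst v, \<not> snd v), False) \<noteq> w (Inr v, False))"
    by (intro generic_ball generic_neq) auto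
  obtain w :: "_ \<Rightarrow> 'a" where residual: "form_determining d (chords (edges w ?E))"
    and trace: "biform_determining (d + 2) (?T w) (vertex w ` ?N)"
    and transversal: "\<forall>(u, v)\<in>?E. transversal (vertex w u) (vertex w v)"
    and neq: "\<forall>v\<in>{..<k} \<times> UNIV. w (Inl (fst v, \<not> snd v), False) \<noteq> w (Inr v, False)"
    using generic_witness[OF generic_conj[OF generic_form_determining_edges[OF chain]
          generic_conj[OF trace generic_conj[OF
              generic_transversal_edges[OF finite_chain_graph irrefl_chain_graph] ends]]]] by blast
  have "\<exists>P\<^sub>1 P\<^sub>2. (P, P\<^sub>1) \<in> edges w ?E \<union> (edges w ?E)\<inverse> \<and> (P, P\<^sub>2) \<in> edges w ?E \<union> (edges w ?E)\<inverse>
      \<and> fst P\<^sub>1 \<noteq> fst P\<^sub>2" if "P \<in> vertex w ` ?N" for P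
    using that neq chain_graph_node_chords[OF _ \<open>k \<le> n\<close>, where w = w] by auto
  with trace residual transversal have "trivial_kernel (mons (d + 2))
    (mon ` (chords (edges w ?E) \<union> seg ` ?T w) \<union> (\<lambda>P. bimon_da P \<circ> bidegree) ` vertex w ` ?N)"
    by (intro castelnuovo_double_points) (auto simp: edges_def)
  moreover have "chords (edges w ?E) \<union> seg ` ?T w \<subseteq>
      chords (edges w ?E \<union> rulings {k + 1..3 * k + 1})"
    unfolding chords_Un image_Un Un_subset_iff
    by (intro conjI le_supI1[OF subset_refl] le_supI1[OF seg_vertices_subset_chords]
        le_supI2[OF seg_nat_columns_subset_rulings])
  ultimately have "trivial_kernel (mons (d + 2))
    (mon ` chords (edges w ?E \<union> rulings {k + 1..3 * k + 1}) \<union>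
      (\<lambda>P. bimon_da P \<circ> bidegree) ` vertex w ` ?N)"
    by (elim trivial_kernel_mono) (intro Un_mono image_mono subset_refl)
  then show ?thesis by blast
qed

lemma determining_lines_of_chains:
  fixes w\<^sub>0 :: "_ \<Rightarrow> 'a::field_char_0"
  assumes "form_determining d (chords (edges w\<^sub>0 (chain_graph n k)))"
    and "d + 2 = 3 * k + 1" and "k \<le> n" and "(k - 1) * (3 * k + 2) + 4 \<le> 2 * n"
  shows "\<exists>L :: 'a secant set. determining_lines (d + 2) (n + 4 * k + 1) L"
proof -
  obtain w :: "_ \<Rightarrow> 'a" where limit: "trivial_kernel (mons (d + 2))
    (mon ` chords (edges w (chain_graph n k) \<union> rulings {k + 1..3 * k + 1}) \<union>
      (\<lambda>P. bimon_da P \<circ> bidegree) ` vertex w ` Inl ` ({..<k} \<times> UNIV))"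
    using chain_limit_determining[OF assms] by blast
  define M where "M = edges w (map_prod Inl Inl ` matching n) \<union> rulings {k + 1..3 * k + 1}"
  define N where "N = edges w (pendants k)"
  have chain: "edges w (chain_graph n k) \<union> rulings {k + 1..3 * k + 1} = M \<union> N"
    by (auto simp: M_def N_def chain_graph_def edges_def image_Un)
  have fst_N: "fst ` N = vertex w ` Inl ` ({..<k} \<times> UNIV)"
    by (simp add: N_def edges_def pendants_def image_image)
  have "{..<k} \<times> UNIV \<subseteq> Field (matching n)" unfolding Field_matching using \<open>k \<le> n\<close> by auto
  then have "fst ` N \<subseteq> vertex w ` Field (map_prod Inl Inl ` matching n)"
    unfolding fst_N Field_map_prod by (intro image_mono)
  from subset_trans[OF image_mono[OF this] seg_vertices_subset_chords]
  have nodes: "seg ` fst ` N \<subseteq> chords M" unfolding M_def chords_Un by (rule le_supI1)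
  from detach_chords[OF nodes limit[unfolded chain chords_Un, folded fst_N]]
  obtain t where
    detached: "form_determining (d + 2) (chords M \<union> chords (map_prod (slide t) id ` N))" ..
  have "card (map_prod (slide t) id ` N) \<le> card (pendants k)"
    unfolding N_def edges_def image_image by (rule card_image_le) (rule finite_pendants)
  moreover have "card M \<le> card (matching n) + card {k + 1..3 * k + 1}"
    unfolding M_def edges_def image_image rulings_def
    by (intro order_trans[OF card_Un_le] add_mono card_image_le finite_matching) simp
  ultimately have "card (M \<union> map_prod (slide t) id ` N) \<le> n + (2 * k + 1) + 2 * k"
    by (intro order_trans[OF card_Un_le] add_mono) (simp_all add: card_pendants card_matching)
  with detached have "determining_lines (d + 2) (n + 4 * k + 1) (M \<union> map_prod (slide t) id ` N)"
    by (simp add: determining_lines_def chords_Un M_def N_def edges_def rulings_def finite_matching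
        finite_pendants)
  then show ?thesis by blast
qed

lemma determining_lines_3k_plus_3:
  fixes L :: "'a::field_char_0 secant set"
  assumes "determining_lines (3 * k + 1) n L" and count: "2 * n = (3 * k + 4) * (k + 1)"
  shows "\<exists>L' :: 'a secant set. determining_lines (3 * k + 3) (n + (2 * k + 3)) L'"
proof -
  have "(k + 1) * (3 * k + 1 + 3) \<le> 2 * n" unfolding count by (simp add: algebra_simps)
  with assms(1) have "\<exists>L' :: 'a secant set.
      determining_lines (3 * k + 1 + 2) (n + (2 * k + 3)) L'"
    by (intro add_ruling_lines[where u = "k + 1"]) simp_all
  then show ?thesis by (simp add: numeral_3_eq_3)
qed

lemma determining_lines_3k_plus_4:
  fixes L :: "'a::field_char_0 secant set"
  assumes "determining_lines (3 * k) n L" and count: "2 * n = (3 * k + 2) * (k + 1)"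
  shows "\<exists>L' :: 'a secant set. determining_lines (3 * k + 4) (n + (4 * k + 6)) L'"
proof -
  have "k + 1 \<le> n" using count by (cases k) (simp_all add: algebra_simps)
  with count have "k * (3 * k + 3) \<le> 2 * (n - (k + 1))" by (simp add: algebra_simps)
  from chain_graph_determining[OF assms(1) \<open>k + 1 \<le> n\<close> _ this] obtain w :: "_ \<Rightarrow> 'a"
    where "form_determining (3 * k + 2) (chords (edges w (chain_graph (n + 1) (k + 1))))" by auto
  then have "\<exists>L' :: 'a secant set.
      determining_lines (3 * k + 2 + 2) (n + 1 + 4 * (k + 1) + 1) L'"
    by (rule determining_lines_of_chains) (use count \<open>k + 1 \<le> n\<close> in \<open>simp_all add: algebra_simps\<close>)
  moreover have "3 * k + 2 + 2 = 3 * k + 4" "n + 1 + 4 * (k + 1) + 1 = n + (4 * k + 6)" by simp_all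
  ultimately show ?thesis by metis
qed

lemma determining_lines_exist:
  fixes k n :: nat
  shows "2 * n = (3 * k + 2) * (k + 1) \<Longrightarrow>
      \<exists>L :: 'a::field_char_0 secant set. determining_lines (3 * k) n L"
    and "2 * n = (3 * k + 4) * (k + 1) \<Longrightarrow>
      \<exists>L :: 'a secant set. determining_lines (3 * k + 1) n L"
proof (induction k arbitrary: n)
  case 0
  {
    case 1
    then have "n = 1" by simp
    then show ?case using determining_lines_rulings[of 0] by auto
  next
    case 2
    then have "n = 2" by simp
    then show ?case using determining_lines_rulings[of 1] by (auto simp: numeral_2_eq_2)
  }
next
  case (Suc k)
  {
    case 1
    define m where "m = n - (2 * k + 3)"
    have "(3 * Suc k + 2) * (Suc k + 1) = (3 * k + 4) * (k + 1) + 2 * (2 * k + 3)"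
      by (simp add: algebra_simps)
    with 1 have m: "n = m + (2 * k + 3)" "2 * m = (3 * k + 4) * (k + 1)" by (auto simp: m_def)
    from Suc.IH(2)[OF m(2)] determining_lines_3k_plus_3[OF _ m(2)] show ?case
      unfolding m(1) mult_Suc_right add.commute[of 3] by blast
  next
    case 2
    define m where "m = n - (4 * k + 6)"
    have "(3 * Suc k + 4) * (Suc k + 1) = (3 * k + 2) * (k + 1) + 2 * (4 * k + 6)"
      by (simp add: algebra_simps)
    with 2 have m: "n = m + (4 * k + 6)" "2 * m = (3 * k + 2) * (k + 1)" by (auto simp: m_def)
    have "3 * Suc k + 1 = 3 * k + 4" by simp
    with Suc.IH(1)[OF m(2)] determining_lines_3k_plus_4[OF _ m(2)] show ?case
      unfolding m(1) by metis
  }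
qed

lemma determining_lines_and_collinear_points_exist:
  fixes k l :: nat
  assumes l: "2 * l = (3 * k + 2) * (k + 1) + 2 * (2 * k + 2)"
  shows "\<exists>L :: 'a::field_char_0 secant set. finite L \<and> card L \<le> l \<and>
    form_determining (3 * k + 2) (chords L \<union> seg ` nat_point ` ({..<k + 1} \<times> {0}))"
proof -
  define n where "n = l - (2 * k + 2)"
  have n: "l = n + (2 * k + 2)" "2 * n = (3 * k + 2) * (k + 1)" using l by (auto simp: n_def)
  obtain L :: "'a secant set" where lines: "determining_lines (3 * k) n L"
    using determining_lines_exist(1)[OF n(2)] by blast
  have "{..<k + 1} \<times> {..3 * k + 2} - {..<k + 1} \<times> {0} = {..<k + 1} \<times> {1..3 * k + 2}" by auto
  then have "card ({..<k + 1} \<times> {..3 * k + 2} - {..<k + 1} \<times> {0}) = 2 * n"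
    by (simp add: n(2) card_cartesian_product del: mult_Suc mult_Suc_right)
  then have "card ({..<k + 1} \<times> {..3 * k + 2} - {..<k + 1} \<times> {0}) \<le> 2 * n" by simp
  from add_ruling_lines_and_points[OF lines _ this, of "2 * k + 2"] show ?thesis
    by (simp add: n(1))
qed

section \<open>The restriction map\<close>

lemma binforms_mult:
  fixes f g :: "'a::field \<times> 'a \<Rightarrow> 'a"
  assumes "f \<in> binforms m" "g \<in> binforms n"
  shows "(\<lambda>x. f x * g x) \<in> binforms (m + n)"
proof -
  obtain a b where f_eq: "f = (\<lambda>(s, t). \<Sum>i\<le>m. a i * s ^ i * t ^ (m - i))"
    and g_eq: "g = (\<lambda>(s, t). \<Sum>j\<le>n. b j * s ^ j * t ^ (n - j))"
    using assms unfolding binforms_def by blast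
  define \<gamma> where "\<gamma> q = (\<Sum>x | x \<in> {..m} \<times> {..n} \<and> fst x + snd x = q. a (fst x) * b (snd x))" for q
  have "f (s, t) * g (s, t) = (\<Sum>q\<le>m + n. \<gamma> q * s ^ q * t ^ (m + n - q))" for s t
  proof -
    let ?f = "\<lambda>x. a (fst x) * s ^ fst x * t ^ (m - fst x)"
      and ?g = "\<lambda>x. b (snd x) * s ^ snd x * t ^ (n - snd x)"
      and ?h = "\<lambda>x. a (fst x) * b (snd x) * s ^ (fst x + snd x) * t ^ (m + n - (fst x + snd x))"
    have "f (s, t) * g (s, t) = (\<Sum>x\<in>{..m} \<times> {..n}. ?f x * ?g x)"
      by (simp add: f_eq g_eq sum_product sum.cartesian_product split_def)
    also have "\<dots> = (\<Sum>x\<in>{..m} \<times> {..n}. ?h x)"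
    proof (rule sum.cong[OF refl])
      fix x assume "x \<in> {..m} \<times> {..n}"
      then have "m + n - (fst x + snd x) = (m - fst x) + (n - snd x)" by auto
      then show "?f x * ?g x = ?h x"
        by (simp add: power_add mult_ac)
    qed
    also have "\<dots> = (\<Sum>q\<le>m + n. \<Sum>x | x \<in> {..m} \<times> {..n} \<and> fst x + snd x = q. ?h x)"
      by (rule sum.group[symmetric]) auto
    also have "\<dots> = (\<Sum>q\<le>m + n. \<gamma> q * s ^ q * t ^ (m + n - q))"
      unfolding \<gamma>_def sum_distrib_right by (intro sum.cong refl) auto
    finally show ?thesis .
  qed
  then show ?thesis unfolding binforms_def by (auto intro!: exI[of _ \<gamma>])
qed

lemma binforms_1: "(\<lambda>_. 1 :: 'a::field) \<in> binforms 0"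
  unfolding binforms_def by (auto intro!: exI[of _ "\<lambda>_. 1"])

lemma binforms_linear: "(\<lambda>(s, t). s * a + t * b) \<in> binforms 1"
  unfolding binforms_def
  by (auto intro!: exI[of _ "\<lambda>j. if j = 0 then b else a"] simp: fun_eq_iff mult.commute)

lemma binforms_power: "f \<in> binforms m \<Longrightarrow> (\<lambda>x. f x ^ n) \<in> binforms (m * n)"
  by (induction n) (auto simp: binforms_1 dest: binforms_mult)

lemma mon_line_vec_binforms:
  assumes "\<alpha> \<in> mons d"
  shows "(\<lambda>(s, t). mon (line_vec z i s t) \<alpha>) \<in> binforms d"
proof -
  have factor: "(\<lambda>x. line_vec z i (fst x) (snd x) m ^ \<alpha> m) \<in> binforms (\<alpha> m)" for m
    using binforms_power[OF binforms_linear, of "z (VA i m)" "z (VB i m)" "\<alpha> m"]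
    by (simp add: line_vec_def split_def)
  have "(\<lambda>x. mon (line_vec z i (fst x) (snd x)) \<alpha>) \<in> binforms (\<alpha> 0 + \<alpha> 1 + \<alpha> 2 + \<alpha> 3)"
    unfolding mon_eq by (intro binforms_mult factor)
  then show ?thesis using assms by (simp add: mons_iff split_def)
qed

definition line_coeff :: "nat \<Rightarrow> (pvar \<Rightarrow> 'a::field) \<Rightarrow> nat \<Rightarrow> nat \<Rightarrow> (nat \<Rightarrow> nat) \<Rightarrow> 'a" where
  "line_coeff d z i j \<alpha> =
     (SOME \<beta>. \<forall>s t. mon (line_vec z i s t) \<alpha> = (\<Sum>j\<le>d. \<beta> j * s ^ j * t ^ (d - j))) j"

lemma mon_line_vec:
  assumes "\<alpha> \<in> mons d"
  shows "mon (line_vec z i s t) \<alpha> = (\<Sum>j\<le>d. line_coeff d z i j \<alpha> * s ^ j * t ^ (d - j))"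
proof -
  have "\<exists>\<beta>. \<forall>s t. mon (line_vec z i s t) \<alpha> = (\<Sum>j\<le>d. \<beta> j * s ^ j * t ^ (d - j))"
    using mon_line_vec_binforms[OF assms, of z i] by (auto simp: binforms_def fun_eq_iff)
  from someI_ex[OF this] show ?thesis unfolding line_coeff_def by blast
qed

lemma evalF_line_vec:
  "evalF d c (line_vec z i s t) =
    (\<Sum>j\<le>d. (\<Sum>\<alpha>\<in>mons d. c \<alpha> * line_coeff d z i j \<alpha>) * s ^ j * t ^ (d - j))"
proof -
  have "evalF d c (line_vec z i s t) =
      (\<Sum>\<alpha>\<in>mons d. \<Sum>j\<le>d. c \<alpha> * line_coeff d z i j \<alpha> * s ^ j * t ^ (d - j))"
    unfolding evalF_eq_sum_mon
    by (rule sum.cong) (simp_all add: mon_line_vec sum_distrib_left mult_ac)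
  then show ?thesis unfolding sum_distrib_right by (subst sum.swap) simp
qed

definition configuration :: "nat \<Rightarrow> nat \<Rightarrow> (pvar \<Rightarrow> 'a::field) \<Rightarrow> (nat \<Rightarrow> 'a) set" where
  "configuration l p z =
     (\<lambda>(i, s, t). line_vec z i s t) ` ({..<l} \<times> UNIV) \<union> point_vec z ` {..<p}"

lemma restr_map_eq_iff:
  "restr_map d l p z c = restr_map d l p z c' \<longleftrightarrow>
    (\<forall>x\<in>configuration l p z. evalF d c x = evalF d c' x)"
proof -
  have "restr_map d l p z c = restr_map d l p z c' \<longleftrightarrow>
      (\<forall>i<l. \<forall>s t. evalF d c (line_vec z i s t) = evalF d c' (line_vec z i s t)) \<and>
      (\<forall>j<p. evalF d c (point_vec z j) = evalF d c' (point_vec z j))"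
    by (auto simp: restr_map_def fun_eq_iff)
  also have "\<dots> \<longleftrightarrow> (\<forall>x\<in>configuration l p z. evalF d c x = evalF d c' x)"
    by (auto simp: configuration_def ball_Un)
  finally show ?thesis .
qed

lemma restr_map_mem_target: "restr_map d l p z c \<in> restr_target d l p"
  by (auto simp: restr_map_def restr_target_def binforms_def evalF_line_vec)

lemma inj_on_restr_map:
  assumes "form_determining d (configuration l p z)"
  shows "inj_on (restr_map d l p z) (forms d)"
proof (rule inj_onI)
  fix c c' :: "(nat \<Rightarrow> nat) \<Rightarrow> 'a"
  assume forms: "c \<in> forms d" "c' \<in> forms d" and eq: "restr_map d l p z c = restr_map d l p z c'"
  have "evalF d (\<lambda>\<alpha>. c \<alpha> - c' \<alpha>) x = evalF d c x - evalF d c' x" for x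
    by (simp add: evalF_eq_sum_mon sum_subtractf left_diff_distrib)
  then have "c \<alpha> - c' \<alpha> = 0" if "\<alpha> \<in> mons d" for \<alpha>
    using form_determiningD[OF assms, of "\<lambda>\<alpha>. c \<alpha> - c' \<alpha>"] eq that by (simp add: restr_map_eq_iff)
  then have "c \<alpha> = c' \<alpha>" for \<alpha>
    using forms by (cases "\<alpha> \<in> mons d") (simp_all add: forms_def)
  then show "c = c'" by blast
qed

definition restr_row :: "nat \<Rightarrow> (pvar \<Rightarrow> 'a::field) \<Rightarrow> nat \<times> nat + nat \<Rightarrow> (nat \<Rightarrow> nat) \<Rightarrow> 'a" where
  "restr_row d z = case_sum (\<lambda>(i, j). line_coeff d z i j) (\<lambda>j. mon (point_vec z j))"

lemma trivial_kernel_restr_rows: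
  assumes "form_determining d (configuration l p z)"
  shows "trivial_kernel (mons d) (restr_row d z ` (({..<l} \<times> {..d}) <+> {..<p}))"
proof (rule trivial_kernel_if_kernel_subset[OF assms[unfolded form_determining_def]], rule subsetI)
  fix c assume "c \<in> kernel (mons d) (restr_row d z ` (({..<l} \<times> {..d}) <+> {..<p}))"
  then have row: "(\<Sum>\<alpha>\<in>mons d. c \<alpha> * restr_row d z x \<alpha>) = 0"
    if "x \<in> ({..<l} \<times> {..d}) <+> {..<p}" for x
    using that by (simp add: kernel_def)
  have "(\<Sum>\<alpha>\<in>mons d. c \<alpha> * line_coeff d z i j \<alpha>) = 0" if "i < l" "j \<le> d" for i j
    using row[of "Inl (i, j)"] that by (simp add: restr_row_def InlI)
  then have "evalF d c (line_vec z i s t) = 0" if "i < l" for i s t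
    using that by (simp add: evalF_line_vec)
  moreover have "evalF d c (point_vec z j) = 0" if "j < p" for j
    using row[of "Inr j"] that by (simp add: restr_row_def evalF_eq_sum_mon InrI)
  ultimately show "c \<in> kernel (mons d) (mon ` configuration l p z)"
    by (auto simp: kernel_def configuration_def simp flip: evalF_eq_sum_mon)
qed

lemma restr_map_surj:
  fixes z :: "pvar \<Rightarrow> 'a::field"
  assumes "form_determining d (configuration l p z)" and card: "l * (d + 1) + p = card (mons d)"
    and target: "(g, v) \<in> restr_target d l p"
  shows "(g, v) \<in> restr_map d l p z ` forms d"
proof -
  let ?I = "({..<l} \<times> {..d}) <+> {..<p}"
  have "\<forall>i\<in>{..<l}. g i \<in> binforms d" using target by (simp add: restr_target_def)
  then have "\<forall>i\<in>{..<l}. \<exists>\<beta>. g i = (\<lambda>(s, t). \<Sum>j\<le>d. \<beta> j * s ^ j * t ^ (d - j))"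
    unfolding binforms_def by blast
  from bchoice[OF this] obtain \<beta> where
    g_eq: "\<forall>i\<in>{..<l}. g i = (\<lambda>(s, t). \<Sum>j\<le>d. \<beta> i j * s ^ j * t ^ (d - j))" by blast
  have index_set: "finite ?I" "card ?I = card (mons d)"
    using card by (simp_all add: card_Plus card_cartesian_product)
  from trivial_kernel_solvable[OF finite_mons index_set trivial_kernel_restr_rows[OF assms(1)],
      of "case_sum (\<lambda>(i, j). \<beta> i j) v"]
  obtain c' where solution: "\<forall>x\<in>?I. (\<Sum>\<alpha>\<in>mons d. c' \<alpha> * restr_row d z x \<alpha>) =
      case_sum (\<lambda>(i, j). \<beta> i j) v x" ..
  define c where "c \<alpha> = (if \<alpha> \<in> mons d then c' \<alpha> else 0)" for \<alpha>
  have c_row: "(\<Sum>\<alpha>\<in>mons d. c \<alpha> * restr_row d z x \<alpha>) = case_sum (\<lambda>(i, j). \<beta> i j) v x"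
    if "x \<in> ?I" for x using solution that by (simp add: c_def)
  have "(\<Sum>\<alpha>\<in>mons d. c \<alpha> * line_coeff d z i j \<alpha>) = \<beta> i j" if "i < l" "j \<le> d" for i j
    using c_row[of "Inl (i, j)"] that by (simp add: restr_row_def InlI)
  then have "evalF d c (line_vec z i s t) = g i (s, t)" if "i < l" for i s t
    using that by (simp add: evalF_line_vec g_eq)
  moreover have "evalF d c (point_vec z j) = v j" if "j < p" for j
    using c_row[of "Inr j"] that by (simp add: restr_row_def evalF_eq_sum_mon InrI)
  ultimately have "restr_map d l p z c = (g, v)"
    using target by (auto simp: restr_map_def restr_target_def fun_eq_iff)
  moreover have "c \<in> forms d" by (simp add: c_def forms_def)
  ultimately show ?thesis by (metis imageI)
qed

lemma bij_betw_restr_map: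
  assumes "form_determining d (configuration l p z)" "l * (d + 1) + p = card (mons d)"
  shows "bij_betw (restr_map d l p z) (forms d) (restr_target d l p)"
  using inj_on_restr_map[OF assms(1)] restr_map_mem_target restr_map_surj[OF assms]
  by (intro bij_betw_imageI) auto

lemma generic_form_determining_configuration:
  fixes z\<^sub>0 :: "pvar \<Rightarrow> 'a::field_char_0"
  assumes "form_determining d (configuration l p z\<^sub>0)"
  shows "generic (\<lambda>z :: pvar \<Rightarrow> 'a. form_determining d (configuration l p z))"
proof -
  define R where "R = (\<lambda>(i, s, t) (z :: pvar \<Rightarrow> 'a). mon (line_vec z i s t)) ` ({..<l} \<times> UNIV)
    \<union> (\<lambda>j z. mon (point_vec z j)) ` {..<p}"
  have R_at: "(\<lambda>r. r z) ` R = mon ` configuration l p z" for z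
    by (simp add: R_def configuration_def image_Un image_image split_def)
  have "poly_fun (\<lambda>z. r z \<alpha>)" if "r \<in> R" for r \<alpha>
    using that unfolding R_def
    by (auto simp: line_vec_def point_vec_def intro!: poly_fun_mon poly_fun.intros)
  then show ?thesis
    using assms generic_trivial_kernel[of "mons d" R z\<^sub>0]
    by (simp add: form_determining_def finite_mons R_at)
qed

text \<open>The points lie on the ruling through \<open>seg (0, 0)\<close> and \<open>seg (1, 0)\<close>.\<close>
lemma determining_configuration_of_chords:
  fixes L :: "'a::field secant set"
  assumes "finite L" "card L \<le> l"
    and determining: "form_determining d (chords L \<union> seg ` nat_point ` ({..<p} \<times> {0}))"
  shows "\<exists>z :: pvar \<Rightarrow> 'a. form_determining d (configuration l p z)"
proof -
  obtain f where covered: "L \<subseteq> f ` {..<l}"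
    using finite_card_le_covered[OF assms(1), of "{..<l}"] assms(2) by auto
  define z :: "pvar \<Rightarrow> 'a" where "z v = (case v of
      VA i m \<Rightarrow> seg (fst (f i)) m | VB i m \<Rightarrow> seg (snd (f i)) m
    | VC m \<Rightarrow> seg (0, 0) m | VE m \<Rightarrow> seg (1, 0) m | VU j \<Rightarrow> 1 - of_nat j | VV j \<Rightarrow> of_nat j)" for v
  have "line_vec z i s t = (\<lambda>m. s * seg (fst (f i)) m + t * seg (snd (f i)) m)" for i s t
    by (simp add: line_vec_def z_def)
  moreover have "point_vec z j = seg (of_nat j, 0)" for j
    by (rule ext) (simp add: point_vec_def z_def seg_def)
  then have "point_vec z ` {..<p} = seg ` nat_point ` ({..<p} \<times> {0})" by force
  ultimately have "chords (f ` {..<l}) \<union> seg ` nat_point ` ({..<p} \<times> {0}) \<subseteq> configuration l p z"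
    by (simp add: configuration_def chords_image)
  then have "chords L \<union> seg ` nat_point ` ({..<p} \<times> {0}) \<subseteq> configuration l p z"
    using chords_mono[OF covered] by auto
  from form_determining_mono[OF determining this] show ?thesis by blast
qed

lemma determining_configuration_exists:
  fixes k \<epsilon> l p :: nat
  assumes "\<epsilon> \<le> 2" and l: "l = ((3 * k + 5 + 2 * \<epsilon>) * k) div 2 + 1 + \<epsilon>"
    and p: "p = (if \<epsilon> = 2 then k + 1 else 0)"
  shows "\<exists>z :: pvar \<Rightarrow> 'a::field_char_0. form_determining (3 * k + \<epsilon>) (configuration l p z)"
proof -
  have twice_l: "2 * l = (3 * k + 5 + 2 * \<epsilon>) * k + 2 * (1 + \<epsilon>)" using l by simp
  consider (zero) "\<epsilon> = 0" | (one) "\<epsilon> = 1" | (two) "\<epsilon> = 2" using assms(1) by linarith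
  then have "\<exists>L :: 'a secant set. finite L \<and> card L \<le> l \<and>
      form_determining (3 * k + \<epsilon>) (chords L \<union> seg ` nat_point ` ({..<p} \<times> {0}))"
  proof cases
    case zero
    then have "2 * l = (3 * k + 2) * (k + 1)" using twice_l by (simp add: algebra_simps)
    from determining_lines_exist(1)[OF this] zero p show ?thesis
      by (simp add: determining_lines_def)
  next
    case one
    then have "2 * l = (3 * k + 4) * (k + 1)" using twice_l by (simp add: algebra_simps)
    from determining_lines_exist(2)[OF this] one p show ?thesis
      by (simp add: determining_lines_def)
  next
    case two
    then have "2 * l = (3 * k + 2) * (k + 1) + 2 * (2 * k + 2)"
      using twice_l by (simp add: algebra_simps)
    from determining_lines_and_collinear_points_exist[OF this] two p show ?thesis by simp
  qed
  then show ?thesis using determining_configuration_of_chords by blast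
qed

lemma six_times_choose_3: "6 * ((d + 3) choose 3) = (d + 1) * (d + 2) * (d + 3)"
proof -
  have "fact d * (6 * ((d + 3) choose 3)) = fact (d + 3)"
    using binomial_fact_lemma[of 3 "d + 3"] by (simp add: fact_numeral mult_ac)
  also have "\<dots> = fact d * ((d + 1) * (d + 2) * (d + 3))"
    by (simp add: numeral_eq_Suc algebra_simps)
  finally show ?thesis by simp
qed

lemma dimension_count:
  fixes k \<epsilon> l p :: nat
  assumes "\<epsilon> \<le> 2" and l: "l = ((3 * k + 5 + 2 * \<epsilon>) * k) div 2 + 1 + \<epsilon>"
    and p: "p = (if \<epsilon> = 2 then k + 1 else 0)"
  shows "l * (3 * k + \<epsilon> + 1) + p = (3 * k + \<epsilon> + 3) choose 3"
proof -
  have twice_l: "2 * l = (3 * k + 5 + 2 * \<epsilon>) * k + 2 * (1 + \<epsilon>)" using l by simp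
  have "6 * (l * (3 * k + \<epsilon> + 1) + p) = 3 * (2 * l) * (3 * k + \<epsilon> + 1) + 6 * p" by simp
  also have "\<dots> = (3 * k + \<epsilon> + 1) * (3 * k + \<epsilon> + 2) * (3 * k + \<epsilon> + 3)"
  proof -
    consider "\<epsilon> = 0" | "\<epsilon> = 1" | "\<epsilon> = 2" using assms(1) by linarith
    then show ?thesis unfolding twice_l by cases (simp_all add: p algebra_simps)
  qed
  finally show ?thesis using six_times_choose_3[of "3 * k + \<epsilon>"] by simp
qed

theorem theorem2p2:
  fixes k \<epsilon> d l p :: nat
  assumes "\<epsilon> \<le> 2" and "d = 3 * k + \<epsilon>" and "d \<ge> 1"
    and "l = ((3 * k + 5 + 2 * \<epsilon>) * k) div 2 + 1 + \<epsilon>"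
    and "p = (if \<epsilon> = 2 then k + 1 else 0)"
  shows "general (\<lambda>z :: pvar \<Rightarrow> 'a::alg_closed_char0.
           bij_betw (restr_map d l p z) (forms d) (restr_target d l p))"
proof -
  obtain z\<^sub>0 :: "pvar \<Rightarrow> 'a" where "form_determining d (configuration l p z\<^sub>0)"
    using determining_configuration_exists[OF assms(1,4,5)] assms(2) by blast
  then have "generic (\<lambda>z :: pvar \<Rightarrow> 'a. form_determining d (configuration l p z))"
    by (rule generic_form_determining_configuration)
  moreover have "l * (d + 1) + p = card (mons d)"
    using dimension_count[OF assms(1,4,5)] by (simp only: assms(2) card_mons)
  ultimately have "generic (\<lambda>z :: pvar \<Rightarrow> 'a.
      bij_betw (restr_map d l p z) (forms d) (restr_target d l p))"
    by (elim generic_mono) (rule bij_betw_restr_map)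
  then show ?thesis by (simp add: general_def generic_def)
qed

end
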